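(* The field of fractions of the diagonal reduction algebra $\mathrm{DR}(sl(2))$ is isomorphic to the field of fractions of $\mathcal{A}_{1,2}$. More precisely, put $E=x\frac{d}{dx}$ and $$f(E):=-\frac{2(E+1)}{2E+3}\Bigl(E(E+2)+\frac{\nu^2}{16(E+1)^2}+\zeta\Bigr).$$ Then the formulas $$z_-\mapsto x^{-1},\qquad t\mapsto\frac{\nu}{2(E+1)},\qquad z_+\mapsto x f(E),\qquad h\mapsto 2E$$ define a homomorphism from $\mathrm{DR}(sl(2))$ to a certain localization of $\mathcal{A}_{1,2}$; the formulas $$x\mapsto z_-^{-1},\qquad \frac{d}{dx}\mapsto\frac12 z_-h,\qquad \nu\mapsto 2C^{(1)},\qquad \zeta\mapsto C^{(2)}$$ define a homomorphism from $\mathcal{A}_{1,2}$ to a certain localization of $\mathrm{DR}(sl(2))$; and the extensions of these two maps to the fields of fractions are inverse to each other and establish an isomorphism of the fields of fractions of $\mathrm{DR}(sl(2))$ and $\mathcal{A}_{1,2}$.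
   Context: The ground field is $\mathbb{C}$. $\mathrm{DR}(sl(2))$ is the unital associative algebra with generators $z_+,z_-,t,h$, in which all elements $h+l$, $l\in\mathbb{Z}$, are invertible (it contains the ring of fractions of $\mathbb{C}[h]$ with these denominators), and with the defining relations $$z_+t=tz_+\frac{h+4}{h+2},\qquad z_+z_-=z_-z_+\frac{h(h+3)}{(h+1)(h+2)}-t^2\frac1h+h,\qquad tz_-=z_-t\frac{h+2}{h},$$ $$[h,z_+]=2z_+,\qquad [h,t]=0,\qquad [h,z_-]=-2z_-.$$ It is a noetherian domain, hence an Ore domain, so it has a (skew) field of fractions. It has the central elements $$C^{(1)}=(h+2)t,\qquad C^{(2)}=z_-z_+\frac{h+3}{h+2}+t^2\frac14+\frac{h(h+4)}{4}.$$ $\mathcal{A}_{1,2}$ is the unital associative algebra generated by the Weyl variables $x,\frac{d}{dx}$, with $[\frac{d}{dx},x]=1$, and by two variables $\nu,\zeta$ that commute with each other and with $x,\frac{d}{dx}$. "Field of fractions" means the skew field of fractions of an Ore domain, and "a certain localization" means a localization in which the elements occurring in denominators in the formulas are inverted.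
   Formalization: As printed the two maps are not inverse (their composite sends ν to 2ν and ζ to -ζ); proved instead: both printed maps are homomorphisms, the first is inverse to the second with ν↦C^(1), ζ↦-C^(2), and the second is inverse to the first with ν, ζ replaced by ν/2, -ζ. *)

theory Defs
  imports Complex_Main
begin

section \<open>Unital associative complex algebras given by generators and relations\<close>

text \<open>
  A presented algebra is the set of formal expressions in the generators modulo the smallest
  congruence that contains the relations and the axioms of unital associative algebras
  over the complex numbers.
\<close>

datatype 'g alg_term =
    Gen 'g
  | Scal complex
  | Plus "'g alg_term" "'g alg_term"  (infixl "\<oplus>" 65)
  | Times "'g alg_term" "'g alg_term"  (infixl "\<otimes>" 70)

inductive pres_eq :: "('g alg_term \<times> 'g alg_term) set \<Rightarrow> 'g alg_term \<Rightarrow> 'g alg_term \<Rightarrow> bool"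
  for R :: "('g alg_term \<times> 'g alg_term) set" where
  rel: "(a, b) \<in> R \<Longrightarrow> pres_eq R a b"
| refl: "pres_eq R a a"
| sym: "pres_eq R a b \<Longrightarrow> pres_eq R b a"
| trans: "pres_eq R a b \<Longrightarrow> pres_eq R b c \<Longrightarrow> pres_eq R a c"
| plus_cong: "pres_eq R a a' \<Longrightarrow> pres_eq R b b' \<Longrightarrow> pres_eq R (a \<oplus> b) (a' \<oplus> b')"
| times_cong: "pres_eq R a a' \<Longrightarrow> pres_eq R b b' \<Longrightarrow> pres_eq R (a \<otimes> b) (a' \<otimes> b')"
| plus_assoc: "pres_eq R (a \<oplus> b \<oplus> c) (a \<oplus> (b \<oplus> c))"
| plus_comm: "pres_eq R (a \<oplus> b) (b \<oplus> a)"
| plus_zero: "pres_eq R (Scal 0 \<oplus> a) a"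
| plus_neg: "pres_eq R (a \<oplus> Scal (-1) \<otimes> a) (Scal 0)"
| times_assoc: "pres_eq R (a \<otimes> b \<otimes> c) (a \<otimes> (b \<otimes> c))"
| times_one: "pres_eq R (Scal 1 \<otimes> a) a"
| distrib_right: "pres_eq R ((a \<oplus> b) \<otimes> c) (a \<otimes> c \<oplus> b \<otimes> c)"
| distrib_left: "pres_eq R (a \<otimes> (b \<oplus> c)) (a \<otimes> b \<oplus> a \<otimes> c)"
| scal_plus: "pres_eq R (Scal (x + y)) (Scal x \<oplus> Scal y)"
| scal_times: "pres_eq R (Scal (x * y)) (Scal x \<otimes> Scal y)"
| scal_central: "pres_eq R (Scal x \<otimes> a) (a \<otimes> Scal x)"

lemma equivp_pres_eq: "equivp (pres_eq R)"
  by (rule equivpI)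
    (auto simp: reflp_def symp_def transp_def intro: pres_eq.refl pres_eq.sym pres_eq.trans)

lemma pres_eq_times_one_right: "pres_eq R (a \<otimes> Scal 1) a"
  by (meson pres_eq.scal_central pres_eq.sym pres_eq.trans pres_eq.times_one)


section \<open>The diagonal reduction algebra of sl(2)\<close>

text \<open>The generator \<open>GHinv l\<close> stands for the inverse of $h+l$.\<close>

datatype dr_gen = GZp | GZm | GT | GH | GHinv int

abbreviation dr_hl :: "int \<Rightarrow> dr_gen alg_term" where
  "dr_hl l \<equiv> Gen GH \<oplus> Scal (of_int l)"

definition dr_rels :: "(dr_gen alg_term \<times> dr_gen alg_term) set" where
  "dr_rels =
     (\<Union>l. {(dr_hl l \<otimes> Gen (GHinv l), Scal 1), (Gen (GHinv l) \<otimes> dr_hl l, Scal 1)}) \<union>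
     {(Gen GZp \<otimes> Gen GT, Gen GT \<otimes> Gen GZp \<otimes> dr_hl 4 \<otimes> Gen (GHinv 2)),
      (Gen GZp \<otimes> Gen GZm,
         Gen GZm \<otimes> Gen GZp \<otimes> Gen GH \<otimes> dr_hl 3 \<otimes> Gen (GHinv 1) \<otimes> Gen (GHinv 2)
         \<oplus> Scal (-1) \<otimes> Gen GT \<otimes> Gen GT \<otimes> Gen (GHinv 0) \<oplus> Gen GH),
      (Gen GT \<otimes> Gen GZm, Gen GZm \<otimes> Gen GT \<otimes> dr_hl 2 \<otimes> Gen (GHinv 0)),
      (Gen GH \<otimes> Gen GZp \<oplus> Scal (-1) \<otimes> (Gen GZp \<otimes> Gen GH), Scal 2 \<otimes> Gen GZp),
      (Gen GH \<otimes> Gen GT \<oplus> Scal (-1) \<otimes> (Gen GT \<otimes> Gen GH), Scal 0),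
      (Gen GH \<otimes> Gen GZm \<oplus> Scal (-1) \<otimes> (Gen GZm \<otimes> Gen GH), Scal (-2) \<otimes> Gen GZm)}"

quotient_type DR = "dr_gen alg_term" / "pres_eq dr_rels"
  by (rule equivp_pres_eq)

instantiation DR :: "{ring, monoid_mult}"
begin

lift_definition zero_DR :: DR is "Scal 0" .
lift_definition one_DR :: DR is "Scal 1" .
lift_definition plus_DR :: "DR \<Rightarrow> DR \<Rightarrow> DR" is Plus by (rule pres_eq.plus_cong)
lift_definition times_DR :: "DR \<Rightarrow> DR \<Rightarrow> DR" is Times by (rule pres_eq.times_cong)
lift_definition uminus_DR :: "DR \<Rightarrow> DR" is "\<lambda>a. Scal (-1) \<otimes> a"
  by (rule pres_eq.times_cong[OF pres_eq.refl])
definition minus_DR :: "DR \<Rightarrow> DR \<Rightarrow> DR" where "minus_DR a b = a + - b"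

instance
proof
  fix a b c :: DR
  show "a + b + c = a + (b + c)" by transfer (rule pres_eq.plus_assoc)
  show comm: "a + b = b + a" for a b :: DR by transfer (rule pres_eq.plus_comm)
  show "0 + a = a" by transfer (rule pres_eq.plus_zero)
  have "a + - a = 0" by transfer (rule pres_eq.plus_neg)
  then show "- a + a = 0" by (simp add: comm)
  show "a - b = a + - b" by (rule minus_DR_def)
  show "a * b * c = a * (b * c)" by transfer (rule pres_eq.times_assoc)
  show "1 * a = a" by transfer (rule pres_eq.times_one)
  show "a * 1 = a" by transfer (rule pres_eq_times_one_right)
  show "(a + b) * c = a * c + b * c" by transfer (rule pres_eq.distrib_right)
  show "a * (b + c) = a * b + a * c" by transfer (rule pres_eq.distrib_left)
qed

end

instance DR :: numeral ..

lift_definition DR_scal :: "complex \<Rightarrow> DR" is Scal .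
lift_definition DR_zp :: DR is "Gen GZp" .
lift_definition DR_zm :: DR is "Gen GZm" .
lift_definition DR_t :: DR is "Gen GT" .
lift_definition DR_h :: DR is "Gen GH" .
lift_definition DR_hinv :: "int \<Rightarrow> DR" is "\<lambda>l. Gen (GHinv l)" .

definition DR_C1 :: DR where
  "DR_C1 = (DR_h + 2) * DR_t"

definition DR_C2 :: DR where
  "DR_C2 = DR_zm * DR_zp * (DR_h + 3) * DR_hinv 2 + DR_t ^ 2 * DR_scal (1/4)
           + DR_h * (DR_h + 4) * DR_scal (1/4)"


section \<open>The Weyl algebra with two additional commuting variables\<close>

datatype A12_gen = GX | GDx | GNu | GZeta

definition A12_rels :: "(A12_gen alg_term \<times> A12_gen alg_term) set" where
  "A12_rels =
     {(Gen GDx \<otimes> Gen GX \<oplus> Scal (-1) \<otimes> (Gen GX \<otimes> Gen GDx), Scal 1),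
      (Gen GNu \<otimes> Gen GZeta, Gen GZeta \<otimes> Gen GNu),
      (Gen GNu \<otimes> Gen GX, Gen GX \<otimes> Gen GNu),
      (Gen GNu \<otimes> Gen GDx, Gen GDx \<otimes> Gen GNu),
      (Gen GZeta \<otimes> Gen GX, Gen GX \<otimes> Gen GZeta),
      (Gen GZeta \<otimes> Gen GDx, Gen GDx \<otimes> Gen GZeta)}"

quotient_type A12 = "A12_gen alg_term" / "pres_eq A12_rels"
  by (rule equivp_pres_eq)

instantiation A12 :: "{ring, monoid_mult}"
begin

lift_definition zero_A12 :: A12 is "Scal 0" .
lift_definition one_A12 :: A12 is "Scal 1" .
lift_definition plus_A12 :: "A12 \<Rightarrow> A12 \<Rightarrow> A12" is Plus by (rule pres_eq.plus_cong)
lift_definition times_A12 :: "A12 \<Rightarrow> A12 \<Rightarrow> A12" is Times by (rule pres_eq.times_cong)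
lift_definition uminus_A12 :: "A12 \<Rightarrow> A12" is "\<lambda>a. Scal (-1) \<otimes> a"
  by (rule pres_eq.times_cong[OF pres_eq.refl])
definition minus_A12 :: "A12 \<Rightarrow> A12 \<Rightarrow> A12" where "minus_A12 a b = a + - b"

instance
proof
  fix a b c :: A12
  show "a + b + c = a + (b + c)" by transfer (rule pres_eq.plus_assoc)
  show comm: "a + b = b + a" for a b :: A12 by transfer (rule pres_eq.plus_comm)
  show "0 + a = a" by transfer (rule pres_eq.plus_zero)
  have "a + - a = 0" by transfer (rule pres_eq.plus_neg)
  then show "- a + a = 0" by (simp add: comm)
  show "a - b = a + - b" by (rule minus_A12_def)
  show "a * b * c = a * (b * c)" by transfer (rule pres_eq.times_assoc)
  show "1 * a = a" by transfer (rule pres_eq.times_one)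
  show "a * 1 = a" by transfer (rule pres_eq_times_one_right)
  show "(a + b) * c = a * c + b * c" by transfer (rule pres_eq.distrib_right)
  show "a * (b + c) = a * b + a * c" by transfer (rule pres_eq.distrib_left)
qed

end

instance A12 :: numeral ..

lift_definition A12_scal :: "complex \<Rightarrow> A12" is Scal .
lift_definition A12_x :: A12 is "Gen GX" .
lift_definition A12_d :: A12 is "Gen GDx" .
lift_definition A12_nu :: A12 is "Gen GNu" .
lift_definition A12_zeta :: A12 is "Gen GZeta" .


section \<open>Homomorphisms, fields of fractions and localizations\<close>

text \<open>The sort \<open>{ring, monoid_mult}\<close> is that of unital associative rings, without the axiom
  $0 \neq 1$ of \<open>ring_1\<close>.\<close>

definition ring_1_hom :: "('a::{ring,monoid_mult} \<Rightarrow> 'b::{ring,monoid_mult}) \<Rightarrow> bool" where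
  "ring_1_hom f \<longleftrightarrow>
     f 1 = 1 \<and> (\<forall>a b. f (a + b) = f a + f b) \<and> (\<forall>a b. f (a * b) = f a * f b)"

text \<open>The complex algebra structures on source and target are given by the maps
  \<open>s\<close>, \<open>s'\<close> that embed the scalars.\<close>

definition alg_hom ::
  "(complex \<Rightarrow> 'a::{ring,monoid_mult}) \<Rightarrow> (complex \<Rightarrow> 'b::{ring,monoid_mult}) \<Rightarrow> ('a \<Rightarrow> 'b) \<Rightarrow> bool"
  where "alg_hom s s' f \<longleftrightarrow> ring_1_hom f \<and> (\<forall>c. f (s c) = s' c)"

definition skew_field_of_fractions :: "('r::{ring,monoid_mult} \<Rightarrow> 'k::division_ring) \<Rightarrow> bool" where
  "skew_field_of_fractions \<iota> \<longleftrightarrow>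
     ring_1_hom \<iota> \<and> inj \<iota> \<and> (\<forall>q. \<exists>a b. b \<noteq> 0 \<and> q = \<iota> a / \<iota> b)"

inductive_set mult_closure :: "'r::monoid_mult set \<Rightarrow> 'r set" for G :: "'r set" where
  one: "1 \<in> mult_closure G"
| mult: "g \<in> G \<Longrightarrow> s \<in> mult_closure G \<Longrightarrow> g * s \<in> mult_closure G"

text \<open>The conditions under which the fractions $a s^{-1}$ with $s \in S$
  form a ring (for a domain; reversibility is then automatic).\<close>

definition right_ore_set :: "'r::{ring,monoid_mult} set \<Rightarrow> bool" where
  "right_ore_set S \<longleftrightarrow>
     1 \<in> S \<and> 0 \<notin> S \<and> (\<forall>s\<in>S. \<forall>s'\<in>S. s * s' \<in> S) \<and>
     (\<forall>a. \<forall>s\<in>S. \<exists>b. \<exists>u\<in>S. a * u = s * b)"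

definition localization :: "('r::{ring,monoid_mult} \<Rightarrow> 'k::division_ring) \<Rightarrow> 'r set \<Rightarrow> 'k set" where
  "localization \<iota> S = {\<iota> a / \<iota> s | a s. s \<in> S}"

text \<open>The elements to be inverted: \<open>x\<close> and $2E+l$ for all integers $l$ on one side, \<open>z\<^sub>-\<close> on the
  other. The elements $2E+l$ are the images of $h+l$; they include, up to scalars and
  commutation with \<open>x\<close>, all denominators of $f(E)$.\<close>

definition A12_denoms :: "A12 set" where
  "A12_denoms = mult_closure ({A12_x} \<union> range (\<lambda>l::int. 2 * (A12_x * A12_d) + A12_scal (of_int l)))"

definition DR_denoms :: "DR set" where
  "DR_denoms = mult_closure {DR_zm}"


section \<open>The two homomorphisms\<close>

text \<open>
  The maps to be proved mutually inverse depend on the normalization of the central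
  generators. Under $t \mapsto \nu/(2(E+1))$ and $z_+ \mapsto x f(E)$ one has $C^{(1)} \mapsto \nu$ and
  $C^{(2)} \mapsto -\zeta$. So the map that is given by these formulas is inverse to
  $\nu \mapsto C^{(1)}$, $\zeta \mapsto -C^{(2)}$, whereas $\nu \mapsto 2C^{(1)}$, $\zeta \mapsto C^{(2)}$ is inverse
  to the map with $\nu/2$ and $-\zeta$ in place of $\nu$ and $\zeta$.
  For this reason the elements \<open>n\<close>, \<open>w\<close> used for $\nu$, $\zeta$ in the first map, and the
  images \<open>c1\<close>, \<open>c2\<close> of $\nu$, $\zeta$ under the second map, are arguments.
\<close>

definition f_elem :: "'l::division_ring \<Rightarrow> 'l \<Rightarrow> 'l \<Rightarrow> 'l" where
  "f_elem n w E = - (2 * (E + 1) / (2 * E + 3)) * (E * (E + 2) + n ^ 2 / (16 * (E + 1) ^ 2) + w)"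

definition DR_to_A12 :: "(A12 \<Rightarrow> 'l::division_ring) \<Rightarrow> 'l \<Rightarrow> 'l \<Rightarrow> (DR \<Rightarrow> 'l) \<Rightarrow> bool" where
  "DR_to_A12 \<iota> n w \<Phi> \<longleftrightarrow>
     (let x = \<iota> A12_x; E = \<iota> A12_x * \<iota> A12_d in
      alg_hom DR_scal (\<iota> \<circ> A12_scal) \<Phi> \<and> range \<Phi> \<subseteq> localization \<iota> A12_denoms \<and>
      \<Phi> DR_zm = inverse x \<and>
      \<Phi> DR_t = n / (2 * (E + 1)) \<and>
      \<Phi> DR_zp = x * f_elem n w E \<and>
      \<Phi> DR_h = 2 * E)"

definition A12_to_DR :: "(DR \<Rightarrow> 'k::division_ring) \<Rightarrow> 'k \<Rightarrow> 'k \<Rightarrow> (A12 \<Rightarrow> 'k) \<Rightarrow> bool" where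
  "A12_to_DR \<iota> c1 c2 \<Psi> \<longleftrightarrow>
     alg_hom A12_scal (\<iota> \<circ> DR_scal) \<Psi> \<and> range \<Psi> \<subseteq> localization \<iota> DR_denoms \<and>
     \<Psi> A12_x = inverse (\<iota> DR_zm) \<and>
     \<Psi> A12_d = 1 / 2 * \<iota> DR_zm * \<iota> DR_h \<and>
     \<Psi> A12_nu = c1 \<and>
     \<Psi> A12_zeta = c2"

definition extends_to_frac ::
  "(complex \<Rightarrow> 'k) \<Rightarrow> (complex \<Rightarrow> 'l) \<Rightarrow> ('r::{ring,monoid_mult} \<Rightarrow> 'k::division_ring) \<Rightarrow>
   ('r \<Rightarrow> 'l::division_ring) \<Rightarrow> ('k \<Rightarrow> 'l) \<Rightarrow> bool" where
  "extends_to_frac s s' \<iota> f F \<longleftrightarrow> alg_hom s s' F \<and> F \<circ> \<iota> = f"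

text \<open>Both maps extend uniquely to the fields of fractions, and the extensions are inverse
  to each other.\<close>

definition inverse_on_fracs ::
  "(DR \<Rightarrow> 'k::division_ring) \<Rightarrow> (A12 \<Rightarrow> 'l::division_ring) \<Rightarrow> (DR \<Rightarrow> 'l) \<Rightarrow> (A12 \<Rightarrow> 'k) \<Rightarrow> bool" where
  "inverse_on_fracs \<iota> \<kappa> \<Phi> \<Psi> \<longleftrightarrow>
     (\<exists>!F. extends_to_frac (\<iota> \<circ> DR_scal) (\<kappa> \<circ> A12_scal) \<iota> \<Phi> F) \<and>
     (\<exists>!G. extends_to_frac (\<kappa> \<circ> A12_scal) (\<iota> \<circ> DR_scal) \<kappa> \<Psi> G) \<and>
     (\<forall>F G. extends_to_frac (\<iota> \<circ> DR_scal) (\<kappa> \<circ> A12_scal) \<iota> \<Phi> F \<and>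
            extends_to_frac (\<kappa> \<circ> A12_scal) (\<iota> \<circ> DR_scal) \<kappa> \<Psi> G \<longrightarrow>
            bij F \<and> bij G \<and> G \<circ> F = id \<and> F \<circ> G = id)"

end

theory Submission
  imports Defs
begin

text \<open>
  Conjugation by \<open>x\<close> shifts \<open>E\<close> by one and fixes the central elements, so under the first map
  the relation between \<open>z\<^sub>+\<close> and \<open>z\<^sub>-\<close> becomes the difference equation that relates $f(E-1)$ and $f(E)$.
  Conversely the relations of \<open>DR\<close> make \<open>C\<^sup>1\<close> and \<open>C\<^sup>2\<close> commute with \<open>z\<^sub>-\<close>, \<open>h\<close> and \<open>t\<close>, which is all
  that the second map needs. A homomorphism from \<open>DR\<close> to a division ring is determined by its values
  at \<open>z\<^sub>-\<close>, \<open>h\<close>, \<open>C\<^sup>1\<close> and \<open>C\<^sup>2\<close>, provided that \<open>z\<^sub>-\<close> is not sent to zero; comparing these values shows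
  that the two composites are the identity. Injectivity of each map, needed for its extension to the
  fractions, follows because the other map extends to the localization that contains its values.
\<close>

subsection \<open>Ring homomorphisms\<close>

text \<open>No basis of either algebra is constructed; nonvanishing and injectivity are read off
  from the division rings and from the maps into them. The obstacle is a circle: a map extends to
  all fractions only if it is injective, while its injectivity is to come from a composite with the
  other extended map. A localization breaks the circle, because there a map only has to be nonzero
  on explicitly known denominators. The computations are organized by E = h/2 and u = t/2. On both
  sides the conjugation that takes E to E - 1 takes u to u + u/E. The difference equation for f and
  the commutation of C^{(2)} with z_- then rest on the same two identities, (E-1)(E+1) = E(E+2) -
  (2E+1) and (1 + 1/E)^2 = 1 + (2E+1)/E^2. Scalar multiples of nu, zeta and of the central elements
  are carried as parameters, so that one argument treats both matching pairs of
  normalizations.\<close>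

lemma ring_1_homD:
  assumes "ring_1_hom f"
  shows "f 1 = 1" "f (a + b) = f a + f b" "f (a * b) = f a * f b"
  using assms by (auto simp: ring_1_hom_def)

lemma ring_1_hom_zero:
  assumes "ring_1_hom f" shows "f 0 = 0"
proof -
  have "f (0 + 0) = f 0 + f 0" using assms by (rule ring_1_homD)
  then show ?thesis by simp
qed

lemma ring_1_hom_uminus:
  assumes "ring_1_hom f" shows "f (- a) = - f a"
proof -
  have "f (a + - a) = f a + f (- a)" using assms by (rule ring_1_homD)
  then have "f a + f (- a) = 0" by (simp add: ring_1_hom_zero[OF assms])
  then show ?thesis by (metis minus_unique)
qed

lemma ring_1_hom_diff: "ring_1_hom f \<Longrightarrow> f (a - b) = f a - f b"
  by (metis diff_conv_add_uminus ring_1_homD(2) ring_1_hom_uminus)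

lemma ring_1_hom_power: "ring_1_hom f \<Longrightarrow> f (a ^ n) = f a ^ n"
  by (induction n) (simp_all add: ring_1_homD)

lemma ring_1_hom_numeral:
  fixes f :: "'a::{ring,monoid_mult,numeral} \<Rightarrow> 'b::{ring,monoid_mult,numeral}"
  shows "ring_1_hom f \<Longrightarrow> f (numeral k) = numeral k"
  by (induction k) (simp_all only: numeral.simps ring_1_homD)

lemma ring_1_hom_of_int:
  fixes f :: "'a::ring_1 \<Rightarrow> 'b::ring_1"
  assumes "ring_1_hom f" shows "f (of_int l) = of_int l"
proof -
  have "f (of_nat n) = of_nat n" for n
    by (induction n) (simp_all add: ring_1_homD[OF assms] ring_1_hom_zero[OF assms])
  then show ?thesis
    by (cases l) (simp_all add: ring_1_hom_diff[OF assms] ring_1_hom_uminus[OF assms] ring_1_homD[OF assms])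
qed

lemma ring_1_hom_inverse:
  fixes f :: "'a::division_ring \<Rightarrow> 'b::division_ring"
  assumes "ring_1_hom f" shows "f (inverse a) = inverse (f a)"
proof (cases "a = 0")
  case False
  then have "f a * f (inverse a) = 1"
    by (metis assms right_inverse ring_1_homD(1,3))
  then show ?thesis by (metis inverse_unique)
qed (simp add: ring_1_hom_zero[OF assms])

lemma ring_1_hom_divide:
  fixes f :: "'a::division_ring \<Rightarrow> 'b::division_ring"
  shows "ring_1_hom f \<Longrightarrow> f (a / b) = f a / f b"
  by (simp add: divide_inverse ring_1_homD ring_1_hom_inverse)

lemma ring_1_hom_comp: "ring_1_hom f \<Longrightarrow> ring_1_hom g \<Longrightarrow> ring_1_hom (g \<circ> f)"
  by (simp add: ring_1_hom_def)

lemma alg_homD: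
  assumes "alg_hom s s' f" shows "ring_1_hom f" "f (s c) = s' c"
  using assms by (auto simp: alg_hom_def)

lemmas hom_simps = ring_1_homD ring_1_hom_zero ring_1_hom_uminus ring_1_hom_diff
  ring_1_hom_power ring_1_hom_numeral

lemma hom_f_elem:
  "ring_1_hom g \<Longrightarrow> g (f_elem n w E) = f_elem (g n) (g w) (g E)"
  by (simp add: f_elem_def hom_simps ring_1_hom_divide)

lemma inj_hom_nonzero: "ring_1_hom f \<Longrightarrow> inj f \<Longrightarrow> a \<noteq> 0 \<Longrightarrow> f a \<noteq> 0"
  by (metis injD ring_1_hom_zero)

subsection \<open>Right fractions\<close>

lemma divide_cancel_right_factor:
  fixes a b c :: "'a::division_ring"
  assumes "c \<noteq> 0" shows "(a * c) / (b * c) = a / b"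
proof (cases "b = 0")
  case False
  then have "(a * c) * (inverse c * inverse b) = a * (c * inverse c) * inverse b"
    by (simp only: mult.assoc)
  then show ?thesis using assms False by (simp add: divide_inverse nonzero_inverse_mult_distrib)
qed simp

text \<open>The hypothesis rearranges to s^{-1} b = c v^{-1}, which moves the inner denominator to
  the right; then (u v)^{-1} = v^{-1} u^{-1}.\<close>

lemma divide_mult_divide_swap:
  fixes a b c s u v :: "'a::division_ring"
  assumes "s \<noteq> 0" "u \<noteq> 0" "v \<noteq> 0" "b * v = s * c"
  shows "a / s * (b / u) = (a * c) / (u * v)"
proof -
  have "inverse s * b = inverse s * (b * v) * inverse v"
    unfolding mult.assoc using assms(3) by simp
  also have "\<dots> = c * inverse v"
    using assms by (simp flip: mult.assoc)
  finally have "a * (inverse s * b) * inverse u = a * (c * inverse v) * inverse u" by simp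
  then show ?thesis
    using assms by (simp add: divide_inverse nonzero_inverse_mult_distrib mult.assoc)
qed

text \<open>Relative to a set because a localization is a subset of a division ring, not a type.
  With \<open>UNIV\<close> the same notion covers maps on a whole field of fractions.\<close>

definition hom_on :: "'a::ring set \<Rightarrow> ('a \<Rightarrow> 'b::ring) \<Rightarrow> bool" where
  "hom_on A F \<longleftrightarrow> (\<forall>p\<in>A. \<forall>q\<in>A. F (p + q) = F p + F q \<and> F (p * q) = F p * F q)"

locale right_fractions =
  fixes \<iota> :: "'r::{ring,monoid_mult} \<Rightarrow> 'k::division_ring" and S :: "'r set"
  assumes hom: "ring_1_hom \<iota>" and inj: "inj \<iota>" and ore: "right_ore_set S"
begin

lemma one_in: "1 \<in> S" and mult_in: "s \<in> S \<Longrightarrow> u \<in> S \<Longrightarrow> s * u \<in> S"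
  using ore by (auto simp: right_ore_set_def)

lemma nonzero: "s \<in> S \<Longrightarrow> \<iota> s \<noteq> 0"
  using ore inj_hom_nonzero[OF hom inj] by (metis right_ore_set_def)

lemma common_multiple:
  assumes "s \<in> S" "u \<in> S"
  obtains v c where "v \<in> S" "s * v = u * c" "s * v \<in> S"
  using ore assms unfolding right_ore_set_def by metis

text \<open>The Ore condition applied to two denominators. The cofactor \<open>c\<close> is only
  known to be an element of the ring, yet its image is nonzero since u c = s v lies in
  \<open>S\<close>.\<close>

lemma common_denominator:
  assumes "s \<in> S" "u \<in> S"
  obtains v c where "s * v \<in> S" "s * v = u * c"
    "\<And>a. \<iota> a / \<iota> s = \<iota> (a * v) / \<iota> (s * v)" "\<And>b. \<iota> b / \<iota> u = \<iota> (b * c) / \<iota> (s * v)"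
proof -
  obtain v c where vc: "v \<in> S" "s * v = u * c" "s * v \<in> S"
    using common_multiple[OF assms] .
  have "\<iota> v \<noteq> 0" using nonzero vc by blast
  have "\<iota> u * \<iota> c \<noteq> 0" using nonzero[OF vc(3)] vc(2) by (simp add: ring_1_homD[OF hom])
  then have "\<iota> c \<noteq> 0" by auto
  have "\<iota> a / \<iota> s = \<iota> (a * v) / \<iota> (s * v)" for a
    using \<open>\<iota> v \<noteq> 0\<close> by (simp add: ring_1_homD[OF hom] divide_cancel_right_factor)
  moreover have "\<iota> b / \<iota> u = \<iota> (b * c) / \<iota> (s * v)" for b
    using \<open>\<iota> c \<noteq> 0\<close> unfolding vc(2) by (simp add: ring_1_homD[OF hom] divide_cancel_right_factor)
  ultimately show ?thesis using that vc by blast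
qed

lemma mult_fractions:
  assumes "s \<in> S" "u \<in> S"
  obtains v c where "v \<in> S" "b * v = s * c" "\<iota> a / \<iota> s * (\<iota> b / \<iota> u) = \<iota> (a * c) / \<iota> (u * v)"
proof -
  obtain v c where vc: "v \<in> S" "b * v = s * c"
    using ore assms unfolding right_ore_set_def by metis
  have "\<iota> b * \<iota> v = \<iota> s * \<iota> c" using vc(2) by (metis ring_1_homD(3)[OF hom])
  then have "\<iota> a / \<iota> s * (\<iota> b / \<iota> u) = (\<iota> a * \<iota> c) / (\<iota> u * \<iota> v)"
    using divide_mult_divide_swap nonzero assms vc by blast
  then show ?thesis using that vc by (simp add: ring_1_homD[OF hom])
qed

lemma localizationI: "s \<in> S \<Longrightarrow> \<iota> a / \<iota> s \<in> localization \<iota> S"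
  unfolding localization_def by blast

lemma localizationE:
  assumes "q \<in> localization \<iota> S" obtains a s where "s \<in> S" "q = \<iota> a / \<iota> s"
  using assms unfolding localization_def by blast

lemma image_in_localization: "\<iota> a \<in> localization \<iota> S"
  using localizationI[OF one_in, of a] by (simp add: ring_1_homD[OF hom])

lemma inverse_in_localization: "s \<in> S \<Longrightarrow> inverse (\<iota> s) \<in> localization \<iota> S"
  using localizationI[of s 1] by (simp add: ring_1_homD[OF hom] divide_inverse)

lemma add_in_localization:
  assumes "p \<in> localization \<iota> S" "q \<in> localization \<iota> S"
  shows "p + q \<in> localization \<iota> S"
proof -
  obtain a s b u where p: "p = \<iota> a / \<iota> s" and q: "q = \<iota> b / \<iota> u" and su: "s \<in> S" "u \<in> S"
    using assms by (meson localizationE)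
  obtain v c where *: "s * v \<in> S" "s * v = u * c"
    "\<And>a. \<iota> a / \<iota> s = \<iota> (a * v) / \<iota> (s * v)" "\<And>b. \<iota> b / \<iota> u = \<iota> (b * c) / \<iota> (s * v)"
    using common_denominator[OF su] by blast
  have "p + q = \<iota> (a * v + b * c) / \<iota> (s * v)"
    unfolding p q *(3)[of a] *(4)[of b] by (simp add: ring_1_homD[OF hom] add_divide_distrib)
  then show ?thesis using *(1) localizationI by metis
qed

lemma mult_in_localization:
  assumes "p \<in> localization \<iota> S" "q \<in> localization \<iota> S"
  shows "p * q \<in> localization \<iota> S"
proof -
  obtain a s b u where p: "p = \<iota> a / \<iota> s" and q: "q = \<iota> b / \<iota> u" and su: "s \<in> S" "u \<in> S"
    using assms by (meson localizationE)
  from su obtain v c where "v \<in> S" "b * v = s * c" "p * q = \<iota> (a * c) / \<iota> (u * v)"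
    unfolding p q by (rule mult_fractions)
  then show ?thesis using su localizationI mult_in by metis
qed

text \<open>The only candidate sends \<iota> a / \<iota> s to f a / f s. Two representatives are
  compared over a common denominator, where injectivity of \<iota> makes the numerators equal in the
  ring itself.\<close>

lemma extension_to_localization:
  fixes f :: "'r \<Rightarrow> 'l::division_ring"
  assumes f: "ring_1_hom f" and nz: "\<And>s. s \<in> S \<Longrightarrow> f s \<noteq> 0"
  shows "\<exists>F. hom_on (localization \<iota> S) F \<and> (\<forall>a. F (\<iota> a) = f a)"
proof -
  \<comment> \<open>Nonvanishing at the product yields f v \<noteq> 0 even for a cofactor
    \<open>v\<close> outside \<open>S\<close>.\<close>
  have f_cancel: "f (a * v) / f (s * v) = f a / f s" if "f (s * v) \<noteq> 0" for a s v
  proof -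
    have "f v \<noteq> 0" using that by (auto simp: ring_1_homD[OF f])
    then show ?thesis by (simp add: ring_1_homD[OF f] divide_cancel_right_factor)
  qed
  have wd: "f a / f s = f b / f u"
    if su: "s \<in> S" "u \<in> S" and eq: "\<iota> a / \<iota> s = \<iota> b / \<iota> u" for a s b u
  proof -
    obtain v c where *: "s * v \<in> S" "s * v = u * c"
      "\<And>a. \<iota> a / \<iota> s = \<iota> (a * v) / \<iota> (s * v)" "\<And>b. \<iota> b / \<iota> u = \<iota> (b * c) / \<iota> (s * v)"
      using common_denominator[OF su] by blast
    have "\<iota> (a * v) / \<iota> (s * v) = \<iota> (b * c) / \<iota> (s * v)" using eq *(3)[of a] *(4)[of b] by simp
    then have "\<iota> (a * v) = \<iota> (b * c)"
      using nonzero[OF *(1)] by (metis nonzero_divide_eq_eq times_divide_eq_right nonzero_eq_divide_eq)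
    then have "a * v = b * c" using inj by (metis injD)
    then show ?thesis using f_cancel nz *(1,2) by metis
  qed
  \<comment> \<open>On the localization the choice of a representative is harmless by
    \<open>wd\<close>; outside it the value is arbitrary, and \<open>hom_on\<close> asks nothing
    there.\<close>
  define F where "F q = (case SOME (a, s). s \<in> S \<and> q = \<iota> a / \<iota> s of (a, s) \<Rightarrow> f a / f s)" for q
  have F: "F (\<iota> a / \<iota> s) = f a / f s" if "s \<in> S" for a s
  proof -
    define P where "P = (\<lambda>(a', s'). s' \<in> S \<and> \<iota> a / \<iota> s = \<iota> a' / \<iota> s')"
    have "P (a, s)" using that by (simp add: P_def)
    then have "P (Eps P)" by (rule someI)
    moreover obtain a' s' where "Eps P = (a', s')" by fastforce
    ultimately show ?thesis
      unfolding F_def P_def[symmetric] using wd[OF that, of s' a a'] by (simp add: P_def)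
  qed
  show ?thesis
    unfolding hom_on_def
  proof (intro exI conjI ballI allI)
    show "F (\<iota> a) = f a" for a
      using F[OF one_in, of a] by (simp add: ring_1_homD[OF hom] ring_1_homD[OF f])
    fix p q assume "p \<in> localization \<iota> S" "q \<in> localization \<iota> S"
    then obtain a s b u where p: "p = \<iota> a / \<iota> s" and q: "q = \<iota> b / \<iota> u" and su: "s \<in> S" "u \<in> S"
      by (meson localizationE)
    obtain v c where *: "s * v \<in> S" "s * v = u * c"
      "\<And>a. \<iota> a / \<iota> s = \<iota> (a * v) / \<iota> (s * v)" "\<And>b. \<iota> b / \<iota> u = \<iota> (b * c) / \<iota> (s * v)"
      using common_denominator[OF su] by blast
    have "p + q = \<iota> (a * v + b * c) / \<iota> (s * v)"
      unfolding p q *(3)[of a] *(4)[of b] by (simp add: ring_1_homD[OF hom] add_divide_distrib)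
    moreover have "p = \<iota> (a * v) / \<iota> (s * v)" "q = \<iota> (b * c) / \<iota> (s * v)"
      using p q * by simp_all
    ultimately show "F (p + q) = F p + F q"
      using F[OF *(1)] by (simp add: ring_1_homD[OF f] add_divide_distrib)
    from su obtain v c where vc: "v \<in> S" "b * v = s * c" "p * q = \<iota> (a * c) / \<iota> (u * v)"
      unfolding p q by (rule mult_fractions)
    have "F (p * q) = f (a * c) / f (u * v)" using vc F mult_in su by metis
    moreover have "f b * f v = f s * f c" using vc(2) by (metis ring_1_homD(3)[OF f])
    then have "f a / f s * (f b / f u) = (f a * f c) / (f u * f v)"
      using divide_mult_divide_swap nz su vc by blast
    ultimately show "F (p * q) = F p * F q"
      using F p q su by (simp add: ring_1_homD[OF f])
  qed
qed

end

text \<open>For the Ore condition on a and s, write s^{-1} a as a right fraction b/u and clear both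
  denominators.\<close>

lemma skew_field_fractions_of_all:
  fixes \<iota> :: "'r::{ring,monoid_mult} \<Rightarrow> 'k::division_ring"
  assumes "skew_field_of_fractions \<iota>"
  shows "right_fractions \<iota> {s. s \<noteq> 0}" "localization \<iota> {s. s \<noteq> 0} = UNIV"
proof -
  have hom: "ring_1_hom \<iota>" and inj: "inj \<iota>" and frac: "\<And>q. \<exists>a b. b \<noteq> 0 \<and> q = \<iota> a / \<iota> b"
    using assms by (auto simp: skew_field_of_fractions_def)
  have nz: "a \<noteq> 0 \<longleftrightarrow> \<iota> a \<noteq> 0" for a
    using inj_hom_nonzero[OF hom inj] ring_1_hom_zero[OF hom] by metis
  have "\<exists>b u. u \<noteq> 0 \<and> a * u = s * b" if "s \<noteq> 0" for a s :: 'r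
  proof -
    obtain b u where u: "u \<noteq> 0" "inverse (\<iota> s) * \<iota> a = \<iota> b / \<iota> u" using frac by blast
    have "\<iota> u \<noteq> 0" using u nz by blast
    then have "inverse (\<iota> s) * \<iota> a * \<iota> u = \<iota> b" using u(2) by (metis nonzero_eq_divide_eq)
    then have "\<iota> s * (inverse (\<iota> s) * (\<iota> a * \<iota> u)) = \<iota> s * \<iota> b" by (simp add: mult.assoc)
    moreover have "\<iota> s \<noteq> 0" using that nz by blast
    ultimately have "\<iota> (a * u) = \<iota> (s * b)" by (simp add: ring_1_homD[OF hom] flip: mult.assoc)
    then show ?thesis using u inj by (metis injD)
  qed
  moreover have "(1 :: 'r) \<noteq> 0" by (simp add: nz ring_1_homD[OF hom])
  moreover have "s * u \<noteq> 0" if "s \<noteq> 0" "u \<noteq> 0" for s u :: 'r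
    using that by (simp add: nz ring_1_homD[OF hom])
  ultimately show "right_fractions \<iota> {s. s \<noteq> 0}"
    using hom inj by unfold_locales (auto simp: right_ore_set_def)
  show "localization \<iota> {s. s \<noteq> 0} = UNIV" using frac by (simp add: localization_def set_eq_iff) metis
qed

subsection \<open>Algebras given by generators and relations\<close>

primrec eval_term :: "(complex \<Rightarrow> 'a::{ring,monoid_mult}) \<Rightarrow> ('g \<Rightarrow> 'a) \<Rightarrow> 'g alg_term \<Rightarrow> 'a" where
  "eval_term s g (Gen i) = g i"
| "eval_term s g (Scal c) = s c"
| "eval_term s g (a \<oplus> b) = eval_term s g a + eval_term s g b"
| "eval_term s g (a \<otimes> b) = eval_term s g a * eval_term s g b"

text \<open>The homomorphism property validates the axioms \<open>scal_plus\<close> and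
  \<open>scal_times\<close> under evaluation, centrality of the image validates
  \<open>scal_central\<close>.\<close>

definition central_scalars :: "(complex \<Rightarrow> 'a::{ring,monoid_mult}) \<Rightarrow> bool" where
  "central_scalars s \<longleftrightarrow> ring_1_hom s \<and> (\<forall>c a. s c * a = a * s c)"

text \<open>The universal property of a presentation: in an induction over the generation of the
  congruence, the algebra axioms hold in the target and only the relations in \<open>R\<close>
  remain as assumptions.\<close>

lemma eval_term_cong:
  assumes "pres_eq R a b" and s: "central_scalars s"
    and R: "\<And>a b. (a, b) \<in> R \<Longrightarrow> eval_term s g a = eval_term s g b"
  shows "eval_term s g a = eval_term s g b"
proof -
  have hom: "ring_1_hom s" and central: "\<And>c a. s c * a = a * s c"
    using s by (auto simp: central_scalars_def)
  show ?thesis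
    using assms(1)
  proof (induction rule: pres_eq.induct)
    case (scal_central x a)
    then show ?case by (simp add: central)
  next
    case (plus_neg a)
    have "s (-1) = - 1" by (simp add: ring_1_hom_uminus[OF hom] ring_1_homD[OF hom])
    then have "s (-1) * eval_term s g a = - eval_term s g a" by (metis minus_mult_left mult_1_left)
    then show ?case by (simp add: ring_1_hom_zero[OF hom])
  qed (simp_all add: R ring_1_homD[OF hom] ring_1_hom_zero[OF hom] algebra_simps)
qed

lemmas DR_abs_eqs = plus_DR.abs_eq times_DR.abs_eq one_DR.abs_eq DR_scal.abs_eq DR_zp.abs_eq
  DR_zm.abs_eq DR_t.abs_eq DR_h.abs_eq DR_hinv.abs_eq

lemma DR_induct [case_names scal zp zm t h hinv plus times]:
  assumes "\<And>c. P (DR_scal c)" "P DR_zp" "P DR_zm" "P DR_t" "P DR_h" "\<And>l. P (DR_hinv l)"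
    "\<And>a b. P a \<Longrightarrow> P b \<Longrightarrow> P (a + b)" "\<And>a b. P a \<Longrightarrow> P b \<Longrightarrow> P (a * b)"
  shows "P a"
proof -
  have "P (abs_DR q)" for q
  proof (induction q)
    case (Gen g)
    then show ?case using assms by (cases g) (simp_all flip: DR_abs_eqs)
  qed (use assms in \<open>simp_all flip: DR_abs_eqs\<close>)
  then show ?thesis by (metis DR.abs_induct)
qed

lemmas A12_abs_eqs = plus_A12.abs_eq times_A12.abs_eq one_A12.abs_eq A12_scal.abs_eq A12_x.abs_eq
  A12_d.abs_eq A12_nu.abs_eq A12_zeta.abs_eq

lemma A12_induct [case_names scal x d nu zeta plus times]:
  assumes "\<And>c. P (A12_scal c)" "P A12_x" "P A12_d" "P A12_nu" "P A12_zeta"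
    "\<And>a b. P a \<Longrightarrow> P b \<Longrightarrow> P (a + b)" "\<And>a b. P a \<Longrightarrow> P b \<Longrightarrow> P (a * b)"
  shows "P a"
proof -
  have "P (abs_A12 q)" for q
  proof (induction q)
    case (Gen g)
    then show ?case using assms by (cases g) (simp_all flip: A12_abs_eqs)
  qed (use assms in \<open>simp_all flip: A12_abs_eqs\<close>)
  then show ?thesis by (metis A12.abs_induct)
qed

lemma central_scalars_DR: "central_scalars DR_scal"
  unfolding central_scalars_def ring_1_hom_def
  by (intro conjI allI; transfer;
      rule pres_eq.refl pres_eq.scal_plus pres_eq.scal_times pres_eq.scal_central)

lemma central_scalars_A12: "central_scalars A12_scal"
  unfolding central_scalars_def ring_1_hom_def
  by (intro conjI allI; transfer;
      rule pres_eq.refl pres_eq.scal_plus pres_eq.scal_times pres_eq.scal_central)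

lemma DR_relations:
  "(DR_h + DR_scal (of_int l)) * DR_hinv l = 1"
  "DR_hinv l * (DR_h + DR_scal (of_int l)) = 1"
  "DR_zp * DR_t = DR_t * DR_zp * (DR_h + DR_scal (of_int 4)) * DR_hinv 2"
  "DR_zp * DR_zm = DR_zm * DR_zp * DR_h * (DR_h + DR_scal (of_int 3)) * DR_hinv 1 * DR_hinv 2
     + DR_scal (-1) * DR_t * DR_t * DR_hinv 0 + DR_h"
  "DR_t * DR_zm = DR_zm * DR_t * (DR_h + DR_scal (of_int 2)) * DR_hinv 0"
  "DR_h * DR_zp + DR_scal (-1) * (DR_zp * DR_h) = DR_scal 2 * DR_zp"
  "DR_h * DR_t + DR_scal (-1) * (DR_t * DR_h) = DR_scal 0"
  "DR_h * DR_zm + DR_scal (-1) * (DR_zm * DR_h) = DR_scal (-2) * DR_zm"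
  by (transfer, rule pres_eq.rel, force simp: dr_rels_def)+

lemma A12_relations:
  "A12_d * A12_x + A12_scal (-1) * (A12_x * A12_d) = A12_scal 1"
  "A12_nu * A12_zeta = A12_zeta * A12_nu"
  "A12_nu * A12_x = A12_x * A12_nu"
  "A12_nu * A12_d = A12_d * A12_nu"
  "A12_zeta * A12_x = A12_x * A12_zeta"
  "A12_zeta * A12_d = A12_d * A12_zeta"
  by (transfer, rule pres_eq.rel, force simp: A12_rels_def)+

subsection \<open>Commuting elements of division rings\<close>

text \<open>As a predicate, commutation of compound expressions can be derived by introduction
  rules, whereas the equation a b = b a is a permuting rewrite rule.\<close>

definition commutes :: "'a::times \<Rightarrow> 'a \<Rightarrow> bool" where
  "commutes a b \<longleftrightarrow> a * b = b * a"

lemma commutes_sym: "commutes a b \<Longrightarrow> commutes b a"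
  by (simp add: commutes_def)

lemma commutes_mult: "commutes a b \<Longrightarrow> commutes a c \<Longrightarrow> commutes a (b * c)"
  for a b c :: "'a::semigroup_mult"
  unfolding commutes_def by (metis mult.assoc)

lemma commutes_add: "commutes a b \<Longrightarrow> commutes a c \<Longrightarrow> commutes a (b + c)"
  for a b c :: "'a::ring"
  by (simp add: commutes_def algebra_simps)

lemma commutes_numeral: "commutes a (numeral k)"
  for a :: "'a::ring_1"
  unfolding commutes_def by (metis mult_of_int_commute of_int_numeral)

lemma commutes_of_int: "commutes a (of_int k)"
  for a :: "'a::ring_1"
  unfolding commutes_def by (metis mult_of_int_commute)

lemma commutes_inverse: "commutes a b \<Longrightarrow> commutes a (inverse b)"
  for a b :: "'a::division_ring"
  unfolding commutes_def by (metis mult_commute_imp_mult_inverse_commute)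

lemma commutes_trivial:
  fixes a :: "'a::ring_1"
  shows "commutes a a" "commutes a 1" "commutes a 0"
  by (simp_all add: commutes_def)

lemma commutes_uminus: "commutes a b \<Longrightarrow> commutes a (- b)" for a b :: "'a::ring"
  by (simp add: commutes_def)

lemma commutes_diff: "commutes a b \<Longrightarrow> commutes a c \<Longrightarrow> commutes a (b - c)"
  for a b c :: "'a::ring"
  by (simp add: commutes_def algebra_simps)

lemma commutes_power: "commutes a b \<Longrightarrow> commutes a (b ^ k)"
  for a b :: "'a::monoid_mult"
  unfolding commutes_def by (metis power_commuting_commutes)

lemma commutes_divide: "commutes a b \<Longrightarrow> commutes a c \<Longrightarrow> commutes a (b / c)"
  for a b c :: "'a::division_ring"
  by (simp add: divide_inverse commutes_mult commutes_inverse)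

lemmas commutes_intros = commutes_trivial commutes_numeral commutes_of_int
  commutes_add commutes_diff commutes_uminus commutes_mult commutes_power commutes_inverse commutes_divide

lemma commutes_numeral_left: "commutes (numeral k) a" for a :: "'a::ring_1"
  by (rule commutes_sym[OF commutes_numeral])

lemma commutes_add_left: "commutes a c \<Longrightarrow> commutes b c \<Longrightarrow> commutes (a + b) c"
  and commutes_mult_left: "commutes a c \<Longrightarrow> commutes b c \<Longrightarrow> commutes (a * b) c"
  for a b c :: "'a::ring"
  using commutes_add commutes_mult commutes_sym by blast+

lemma power2_divide_commuting:
  fixes a b :: "'a::division_ring"
  assumes "commutes a b" shows "a ^ 2 / b ^ 2 = (a / b) * (a / b)"
proof -
  have c: "a * inverse b = inverse b * a"
    using commutes_inverse[OF assms] by (simp add: commutes_def)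
  have "a / b * (a / b) = a * (inverse b * a) * inverse b"
    by (simp add: divide_inverse mult.assoc)
  also have "\<dots> = a * a * (inverse b * inverse b)"
    unfolding c[symmetric] by (simp add: mult.assoc)
  also have "\<dots> = a ^ 2 / b ^ 2"
    by (cases "b = 0") (simp_all add: power2_eq_square divide_inverse nonzero_inverse_mult_distrib)
  finally show ?thesis ..
qed

text \<open>An element c/(E+1), with c fixed by the conjugation that sends E to E - 1, goes to c/E,
  that is, u goes to u + u/E. This square therefore occurs twice: in f(E - 1) and in the conjugate
  of C^{(2)}.\<close>

lemma shift_square:
  fixes u E :: "'a::division_ring"
  assumes "commutes u E" "E \<noteq> 0"
  shows "(u + u * inverse E) * (u + u * inverse E) = u * u + u * u * (2 * E + 1) * inverse E * inverse E"
proof -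
  have c: "inverse E * u = u * inverse E"
    using commutes_inverse[OF assms(1)] by (simp add: commutes_def)
  have c': "inverse E * (u * y) = u * (inverse E * y)" for y
    by (metis c mult.assoc)
  show ?thesis
    using assms(2) by (simp add: algebra_simps c c' mult_2)
qed

text \<open>The class \<open>division_ring\<close> allows any characteristic; numerals are units
  here because they are images of units of the complex numbers.\<close>

lemma central_scalars_numeral_nonzero:
  fixes s :: "complex \<Rightarrow> 'd::division_ring"
  assumes "central_scalars s"
  shows "(numeral k :: 'd) \<noteq> 0"
proof
  have hom: "ring_1_hom s" using assms by (simp add: central_scalars_def)
  assume "(numeral k :: 'd) = 0"
  then have "s (numeral k) * s (inverse (numeral k)) = 0"
    by (simp add: ring_1_hom_numeral[OF hom])
  moreover have "s (numeral k) * s (inverse (numeral k)) = 1"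
    using ring_1_homD(3)[OF hom, of "numeral k" "inverse (numeral k)"] ring_1_homD(1)[OF hom] by simp
  ultimately show False by auto
qed

lemma central_scalars_commutes: "central_scalars s \<Longrightarrow> commutes (s c) a"
  "central_scalars s \<Longrightarrow> commutes a (s c)"
  by (simp_all add: central_scalars_def commutes_def)

subsection \<open>Homomorphisms from the two algebras to division rings\<close>

lemma A12_lift:
  fixes s :: "complex \<Rightarrow> 'd::division_ring"
  assumes s: "central_scalars s" and "d * x = x * d + 1" "commutes n w"
    "commutes n x" "commutes n d" "commutes w x" "commutes w d"
  obtains \<Psi> where "alg_hom A12_scal s \<Psi>" "\<Psi> A12_x = x" "\<Psi> A12_d = d" "\<Psi> A12_nu = n" "\<Psi> A12_zeta = w"
proof -
  have hom: "ring_1_hom s" using s by (simp add: central_scalars_def)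
  define g where "g = (\<lambda>i. case i of GX \<Rightarrow> x | GDx \<Rightarrow> d | GNu \<Rightarrow> n | GZeta \<Rightarrow> w)"
  have R: "eval_term s g a = eval_term s g b" if "(a, b) \<in> A12_rels" for a b
    using that assms unfolding A12_rels_def
    by (auto simp: g_def hom_simps[OF hom] commutes_def)
  have "\<exists>\<Psi>. \<forall>q. \<Psi> (abs_A12 q) = eval_term s g q"
  proof (intro exI allI)
    fix q
    have "pres_eq A12_rels (rep_A12 (abs_A12 q)) q"
      by (rule Quotient3_rep_abs[OF Quotient3_A12]) (rule pres_eq.refl)
    then show "eval_term s g (rep_A12 (abs_A12 q)) = eval_term s g q"
      by (rule eval_term_cong[OF _ s R])
  qed
  then obtain \<Psi> where \<Psi>: "\<And>q. \<Psi> (abs_A12 q) = eval_term s g q" by blast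
  have plus: "\<Psi> (a + b) = \<Psi> a + \<Psi> b" and times: "\<Psi> (a * b) = \<Psi> a * \<Psi> b" for a b
    by (induct a rule: A12.abs_induct, induct b rule: A12.abs_induct, simp add: A12_abs_eqs \<Psi>)+
  have "alg_hom A12_scal s \<Psi>"
    by (simp add: alg_hom_def ring_1_hom_def plus times) (simp add: A12_abs_eqs \<Psi> hom_simps[OF hom])
  then show ?thesis
    by (rule that) (simp_all add: A12_abs_eqs \<Psi> g_def)
qed

text \<open>The universal property of \<open>DR\<close> for division rings. There the image of
  \<open>GHinv l\<close> has to be the inverse of h + l, so the data are four elements for which
  every h + l is nonzero.\<close>

lemma DR_lift:
  fixes s :: "complex \<Rightarrow> 'd::division_ring"
  assumes s: "central_scalars s" and nz: "\<And>l. h + of_int l \<noteq> 0"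
    and "zp * t = t * zp * (h + 4) * inverse (h + 2)"
    and "zp * zm = zm * zp * h * (h + 3) * inverse (h + 1) * inverse (h + 2) - t * t * inverse h + h"
    and "t * zm = zm * t * (h + 2) * inverse h"
    and "h * zp = zp * h + 2 * zp" "h * t = t * h" "h * zm = zm * h - 2 * zm"
  obtains \<Phi> where "alg_hom DR_scal s \<Phi>" "\<Phi> DR_zp = zp" "\<Phi> DR_zm = zm" "\<Phi> DR_t = t" "\<Phi> DR_h = h"
proof -
  have hom: "ring_1_hom s" using s by (simp add: central_scalars_def)
  define g where "g = (\<lambda>i. case i of GZp \<Rightarrow> zp | GZm \<Rightarrow> zm | GT \<Rightarrow> t | GH \<Rightarrow> h
    | GHinv l \<Rightarrow> inverse (h + of_int l))"
  have sm: "s (-1) = -1" "s 2 = 2" "s (-2) = -2" "s 3 = 3" "s 4 = 4" "s 0 = 0" "s 1 = 1"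
    by (simp_all add: hom_simps[OF hom])
  have R: "eval_term s g a = eval_term s g b" if "(a, b) \<in> dr_rels" for a b
    using that assms unfolding dr_rels_def
    by (auto simp: g_def ring_1_hom_of_int[OF hom] sm)
  have "\<exists>\<Phi>. \<forall>q. \<Phi> (abs_DR q) = eval_term s g q"
  proof (intro exI allI)
    fix q
    have "pres_eq dr_rels (rep_DR (abs_DR q)) q"
      by (rule Quotient3_rep_abs[OF Quotient3_DR]) (rule pres_eq.refl)
    then show "eval_term s g (rep_DR (abs_DR q)) = eval_term s g q"
      by (rule eval_term_cong[OF _ s R])
  qed
  then obtain \<Phi> where \<Phi>: "\<And>q. \<Phi> (abs_DR q) = eval_term s g q" by blast
  have plus: "\<Phi> (a + b) = \<Phi> a + \<Phi> b" and times: "\<Phi> (a * b) = \<Phi> a * \<Phi> b" for a b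
    by (induct a rule: DR.abs_induct, induct b rule: DR.abs_induct, simp add: DR_abs_eqs \<Phi>)+
  have "alg_hom DR_scal s \<Phi>"
    by (simp add: alg_hom_def ring_1_hom_def plus times) (simp add: DR_abs_eqs \<Phi> hom_simps[OF hom])
  then show ?thesis
    by (rule that) (simp_all add: DR_abs_eqs \<Phi> g_def)
qed

text \<open>The relation for \<open>GHinv l\<close> exhibits an inverse of the image of h + l, and 1
  \<noteq> 0 in a division ring.\<close>

lemma DR_hom_hinv:
  fixes s :: "complex \<Rightarrow> 'd::division_ring"
  assumes "alg_hom DR_scal s \<Phi>" "ring_1_hom s"
  shows "\<Phi> DR_h + of_int l \<noteq> 0" "\<Phi> (DR_hinv l) = inverse (\<Phi> DR_h + of_int l)"
proof -
  note hom = alg_homD(1)[OF assms(1)]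
  have "\<Phi> ((DR_h + DR_scal (of_int l)) * DR_hinv l) = \<Phi> 1" by (simp only: DR_relations)
  then have *: "(\<Phi> DR_h + of_int l) * \<Phi> (DR_hinv l) = 1"
    by (simp add: hom_simps[OF hom] alg_homD(2)[OF assms(1)] ring_1_hom_of_int[OF assms(2)])
  show nz: "\<Phi> DR_h + of_int l \<noteq> 0"
  proof
    assume "\<Phi> DR_h + of_int l = 0" then show False using * by simp
  qed
  show "\<Phi> (DR_hinv l) = inverse (\<Phi> DR_h + of_int l)"
    using inverse_unique[OF *] by simp
qed

lemma DR_hom_relations:
  fixes s :: "complex \<Rightarrow> 'd::division_ring"
  assumes "alg_hom DR_scal s \<Phi>" "ring_1_hom s"
    and "zp = \<Phi> DR_zp" "zm = \<Phi> DR_zm" "t = \<Phi> DR_t" "h = \<Phi> DR_h"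
  shows "zp * t = t * zp * (h + 4) * inverse (h + 2)"
    "zp * zm = zm * zp * h * (h + 3) * inverse (h + 1) * inverse (h + 2) - t * t * inverse h + h"
    "t * zm = zm * t * (h + 2) * inverse h"
    "h * zp = zp * h + 2 * zp" "h * t = t * h" "h * zm = zm * h - 2 * zm"
proof -
  note hom = alg_homD(1)[OF assms(1)]
  have sm: "s (-1) = -1" "s 2 = 2" "s (-2) = -2" "s 3 = 3" "s 4 = 4" "s 0 = 0" "s 1 = 1"
    by (simp_all add: hom_simps[OF assms(2)])
  note rel = DR_relations(3-)[THEN arg_cong[where f = \<Phi>]]
  note rel = rel[unfolded hom_simps[OF hom] DR_hom_hinv(2)[OF assms(1,2)] alg_homD(2)[OF assms(1)]
    ring_1_hom_of_int[OF assms(2)], folded assms(3-)]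
  show "zp * t = t * zp * (h + 4) * inverse (h + 2)" using rel(1) by simp
  show "zp * zm = zm * zp * h * (h + 3) * inverse (h + 1) * inverse (h + 2) - t * t * inverse h + h"
    using rel(2) by (simp add: sm)
  show "t * zm = zm * t * (h + 2) * inverse h" using rel(3) by simp
  show "h * zp = zp * h + 2 * zp" using rel(4) by (simp add: sm algebra_simps)
  show "h * t = t * h" using rel(5) by (simp add: sm)
  show "h * zm = zm * h - 2 * zm" using rel(6) by (simp add: sm algebra_simps)
qed

lemma A12_hom_relations:
  fixes s :: "complex \<Rightarrow> 'd::division_ring"
  assumes "alg_hom A12_scal s \<Psi>" "ring_1_hom s"
  shows "\<Psi> A12_d * \<Psi> A12_x = \<Psi> A12_x * \<Psi> A12_d + 1"
    "commutes (\<Psi> A12_nu) (\<Psi> A12_zeta)" "commutes (\<Psi> A12_nu) (\<Psi> A12_x)"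
    "commutes (\<Psi> A12_nu) (\<Psi> A12_d)" "commutes (\<Psi> A12_zeta) (\<Psi> A12_x)"
    "commutes (\<Psi> A12_zeta) (\<Psi> A12_d)"
proof -
  note hom = alg_homD(1)[OF assms(1)]
  have sm: "s (-1) = -1" "s 1 = 1"
    by (simp_all add: hom_simps[OF assms(2)])
  note rel = A12_relations[THEN arg_cong[where f = \<Psi>], unfolded hom_simps[OF hom] alg_homD(2)[OF assms(1)]]
  show "\<Psi> A12_d * \<Psi> A12_x = \<Psi> A12_x * \<Psi> A12_d + 1"
    using rel(1) by (simp add: sm algebra_simps)
qed (use A12_relations[THEN arg_cong[where f = \<Psi>]] in
  \<open>simp_all add: commutes_def hom_simps[OF alg_homD(1)[OF assms(1)]]\<close>)

lemma A12_hom_eqI: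
  assumes "alg_hom A12_scal s \<Psi>" "alg_hom A12_scal s \<Psi>'"
    "\<Psi> A12_x = \<Psi>' A12_x" "\<Psi> A12_d = \<Psi>' A12_d" "\<Psi> A12_nu = \<Psi>' A12_nu" "\<Psi> A12_zeta = \<Psi>' A12_zeta"
  shows "\<Psi> = \<Psi>'"
proof
  fix a show "\<Psi> a = \<Psi>' a"
    using assms by (induction a rule: A12_induct) (simp_all add: alg_hom_def ring_1_hom_def)
qed

lemma DR_hom_eqI:
  fixes s :: "complex \<Rightarrow> 'd::division_ring"
  assumes "alg_hom DR_scal s \<Phi>" "alg_hom DR_scal s \<Phi>'" "ring_1_hom s"
    "\<Phi> DR_zp = \<Phi>' DR_zp" "\<Phi> DR_zm = \<Phi>' DR_zm" "\<Phi> DR_t = \<Phi>' DR_t" "\<Phi> DR_h = \<Phi>' DR_h"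
  shows "\<Phi> = \<Phi>'"
proof
  note hom = alg_homD(1)[OF assms(1)] alg_homD(1)[OF assms(2)]
  fix a show "\<Phi> a = \<Phi>' a"
  proof (induction a rule: DR_induct)
    case (scal c)
    then show ?case using alg_homD(2)[OF assms(1)] alg_homD(2)[OF assms(2)] by simp
  next
    case (hinv l)
    then show ?case using DR_hom_hinv(2)[OF assms(1,3)] DR_hom_hinv(2)[OF assms(2,3)] assms(7) by simp
  next
    case (plus a b)
    then show ?case by (simp add: ring_1_homD(2)[OF hom(1)] ring_1_homD(2)[OF hom(2)])
  next
    case (times a b)
    then show ?case by (simp add: ring_1_homD(3)[OF hom(1)] ring_1_homD(3)[OF hom(2)])
  qed (rule assms)+
qed

section \<open>Rewriting and conjugation in noncommutative rings\<close>

lemma inverse_cancel_left: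
  fixes a b :: "'a::division_ring"
  assumes "a \<noteq> 0" shows "a * (inverse a * b) = b" "inverse a * (a * b) = b"
  using assms by (simp_all flip: mult.assoc)

lemma left_commute: "a * b = b * a \<Longrightarrow> a * (b * c) = b * (a * c)" for a b c :: "'a::semigroup_mult"
  by (metis mult.assoc)

text \<open>Written as repeated sums, small multiples from either side share one normal form without
  commutativity.\<close>

lemma small_numeral_mult:
  fixes a :: "'a::ring_1"
  shows "2 * a = a + a" "3 * a = a + a + a" "4 * a = a + a + a + a"
    "a * 2 = a + a" "a * 3 = a + a + a" "a * 4 = a + a + a + a"
proof -
  have "3 = (1 + 1 + 1 :: 'a)" "4 = (1 + 1 + 1 + 1 :: 'a)" by simp_all
  then show "3 * a = a + a + a" "4 * a = a + a + a + a" "a * 3 = a + a + a" "a * 4 = a + a + a + a"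
    by (simp_all only: ring_distribs mult_1_left mult_1_right)
qed (simp_all add: mult_2 mult_2_right)

text \<open>Inner automorphisms turn conjugation of a rational expression such as
  \<open>f_elem\<close> into substitution of the conjugates of its arguments.\<close>

lemma ring_1_hom_conj:
  fixes x :: "'a::division_ring"
  assumes "x \<noteq> 0" shows "ring_1_hom (\<lambda>a. x * a * inverse x)"
proof -
  have "x * (a * b) * inverse x = x * a * inverse x * (x * b * inverse x)" for a b
  proof -
    have "x * a * inverse x * (x * b * inverse x) = x * a * (inverse x * x) * b * inverse x"
      by (simp only: mult.assoc)
    then show ?thesis using assms by (simp add: mult.assoc inverse_cancel_left)
  qed
  then show ?thesis using assms by (simp add: ring_1_hom_def ring_distribs)
qed

lemma conj_commuting:
  fixes x :: "'a::division_ring"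
  assumes "x \<noteq> 0" "commutes x a" shows "x * a * inverse x = a"
  using assms by (simp add: commutes_def mult.assoc)

subsection \<open>The relations of \<open>DR\<close> in the fractions of \<open>A12\<close>\<close>

text \<open>The elements \<open>n\<close> and \<open>w\<close> stand for nu and zeta up to scalar
  factors, so one computation serves every normalization of these central variables.\<close>

locale weyl_rep =
  fixes s :: "complex \<Rightarrow> 'd::division_ring" and x d n w :: 'd
  assumes s: "central_scalars s"
    and weyl: "d * x = x * d + 1"
    and n_w: "commutes n w" and n_x: "commutes n x" and n_d: "commutes n d"
    and w_x: "commutes w x" and w_d: "commutes w d"
    and x_nz: "x \<noteq> 0" and h_nz: "2 * (x * d) + of_int l \<noteq> 0"
begin

definition E where "E = x * d"
definition h where "h = 2 * E"
definition t where "t = n / (2 * (E + 1))"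
definition f where "f = f_elem n w E"

lemmas numeral_nz = central_scalars_numeral_nonzero[OF s]

lemma hl_nz: "h + of_int l \<noteq> 0"
  using h_nz[of l] by (simp add: h_def E_def)

lemma hk_nz: "h \<noteq> 0" "h + 1 \<noteq> 0" "h + 2 \<noteq> 0" "h + 3 \<noteq> 0"
  using hl_nz[of 0] hl_nz[of 1] hl_nz[of 2] hl_nz[of 3] by simp_all

lemma h_eqs: "h + 2 = 2 * (E + 1)" "h + 3 = 2 * E + 3" "h + 1 = 2 * E + 1"
  by (simp_all add: h_def algebra_simps)

lemma E_nz: "E \<noteq> 0" "E + 1 \<noteq> 0"
  using hk_nz(1) hk_nz(3) unfolding h_eqs(1) by (metis h_def mult_zero_right)+

lemma n_E: "commutes n E" and w_E: "commutes w E" and E_n: "commutes E n" and E_w: "commutes E w"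
  using commutes_mult n_x n_d w_x w_d commutes_sym unfolding E_def by blast+

lemma E_h: "commutes E h" and h_E: "commutes h E"
  using commutes_mult commutes_numeral commutes_trivial commutes_sym unfolding h_def by blast+

lemma E_t: "commutes E t"
  unfolding t_def by (intro commutes_intros E_n)

lemma E_f: "commutes E f" and n_f: "commutes n f"
  unfolding f_def f_elem_def by (intro commutes_intros E_n E_w n_E w_E n_w commutes_sym[OF n_w])+

lemma E_x: "E * x = x * (E + 1)"
  unfolding E_def by (simp add: mult.assoc weyl algebra_simps)

lemma conj_E: "x * E * inverse x = E - 1"
proof -
  have "x * E = (E - 1) * x" using E_x by (simp add: algebra_simps)
  then show ?thesis using x_nz by (simp add: mult.assoc)
qed

lemma conj_f: "x * f * inverse x = f_elem n w (E - 1)"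
  using hom_f_elem[OF ring_1_hom_conj[OF x_nz], of n w E] conj_E
    conj_commuting[OF x_nz commutes_sym[OF n_x]] conj_commuting[OF x_nz commutes_sym[OF w_x]]
  by (simp add: f_def)

text \<open>Half of \<open>t\<close>. Its square is the term n^2 / (16 (E+1)^2) of f, which makes f
  comparable with the t^2 in the relations.\<close>

definition u where "u = n / (4 * (E + 1))"

lemma E_u: "commutes E u" and u_E: "commutes u E"
  unfolding u_def by (intro commutes_intros E_n commutes_sym[of E])+

lemma t_u: "t = 2 * u"
proof -
  have "4 * (E + 1) = 2 * (E + 1) * 2" by (simp add: small_numeral_mult algebra_simps)
  then have "inverse (4 * (E + 1)) = inverse 2 * inverse (2 * (E + 1))"
    using hk_nz(3) numeral_nz unfolding h_eqs by (metis nonzero_inverse_mult_distrib)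
  moreover have "2 * (n * (inverse 2 * y)) = n * y" for y
  proof -
    have "2 * n = n * 2" by (metis mult_2 mult_2_right)
    then have "2 * (n * (inverse 2 * y)) = n * (2 * inverse 2) * y" by (metis mult.assoc)
    then show ?thesis using numeral_nz[of "num.Bit0 num.One"] by simp
  qed
  ultimately show ?thesis unfolding t_def u_def by (simp only: divide_inverse)
qed

text \<open>Commutation of \<open>n\<close> with \<open>y\<close> makes the quotient of squares the
  square of the quotient. It is applied at E and at E - 1.\<close>

lemma f_elem_squares:
  assumes "commutes n y"
  shows "f_elem n w y = - (2 * (y + 1) / (2 * y + 3)) *
    (y * (y + 2) + n / (4 * (y + 1)) * (n / (4 * (y + 1))) + w)"
proof -
  have "n ^ 2 / (4 * (y + 1)) ^ 2 = n / (4 * (y + 1)) * (n / (4 * (y + 1)))"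
    by (rule power2_divide_commuting) (intro commutes_intros assms)
  moreover have "(4 * (y + 1)) ^ 2 = 16 * (y + 1) ^ 2"
  proof -
    have "(y + 1) * 4 = 4 * (y + 1)" using commutes_numeral unfolding commutes_def by blast
    then have "(4 * (y + 1)) ^ 2 = (4 * 4) * ((y + 1) * (y + 1))"
      unfolding power2_eq_square by (metis mult.assoc)
    also have "4 * 4 = (16 :: 'd)" by simp
    finally show ?thesis by (simp only: power2_eq_square)
  qed
  ultimately show ?thesis by (simp add: f_elem_def)
qed

text \<open>\<open>A\<close> is the bracket in f(E), and \<open>A'\<close> the bracket in f(E - 1)
  with n/(4E) expressed by \<open>u\<close>.\<close>

definition A where "A = E * (E + 2) + u * u + w"
definition A' where "A' = (E - 1) * (E + 1) + (u + u * inverse E) * (u + u * inverse E) + w"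

lemma f_A: "f = - (h + 2) * inverse (h + 3) * A"
  unfolding f_def f_elem_squares[OF n_E] A_def u_def h_eqs by (simp only: divide_inverse minus_mult_left)

text \<open>Both sides times E equal n/4, since u (E+1) = n/4.\<close>

lemma u_shift: "n / (4 * E) = u + u * inverse E"
proof -
  have "u * (1 + inverse E) * E = u * (E + 1)"
    using E_nz(1) by (simp add: mult.assoc ring_distribs)
  also have "\<dots> = n / 4"
  proof -
    have "4 * (E + 1) = (E + 1) * 4" using commutes_numeral_left unfolding commutes_def by blast
    then have "u = n * (inverse 4 * inverse (E + 1))"
      using E_nz(2) numeral_nz unfolding u_def divide_inverse by (metis nonzero_inverse_mult_distrib)
    then show ?thesis using left_inverse[OF E_nz(2)] by (simp only: mult.assoc divide_inverse mult_1_right)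
  qed
  finally have "u * (1 + inverse E) = n / 4 / E"
    using E_nz(1) by (simp add: nonzero_eq_divide_eq)
  moreover have "inverse E * inverse 4 = inverse 4 * inverse E"
    using commutes_inverse[OF commutes_numeral, of "inverse E"] by (simp add: commutes_def)
  moreover have "inverse (4 * E) = inverse E * inverse 4"
    using E_nz(1) numeral_nz by (rule nonzero_inverse_mult_distrib[rotated])
  ultimately show ?thesis
    by (simp only: divide_inverse mult.assoc ring_distribs mult_1_right)
qed

lemma f_shift_A': "f_elem n w (E - 1) = - h * inverse (h + 1) * A'"
proof -
  have c: "commutes n (E - 1)" by (intro commutes_intros n_E)
  have eqs: "2 * (E - 1) + 3 = 2 * E + 1" "E - 1 + 1 = E" "E - 1 + 2 = E + 1"
    by (simp_all add: algebra_simps)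
  show ?thesis
    unfolding f_elem_squares[OF c] eqs A'_def u_shift[symmetric] h_eqs
    unfolding h_def by (simp only: divide_inverse minus_mult_left)
qed

text \<open>The quadratic part contributes (E-1)(E+1) = E(E+2) - (2E+1) with 2E+1 = h+1; the square
  of the shifted \<open>u\<close> contributes the last summand.\<close>

lemma A'_A: "A' = A - (h + 1) + u * u * (h + 1) * inverse E * inverse E"
  unfolding A'_def A_def shift_square[OF u_E E_nz(1)] h_eqs
  by (simp add: algebra_simps mult_2 mult_2_right)

lemma E_A: "commutes E A"
  unfolding A_def by (intro commutes_intros E_w E_u)

lemma h_intro: "commutes E y \<Longrightarrow> commutes h y"
  unfolding h_def by (blast intro: commutes_mult_left commutes_numeral_left)

text \<open>All factors commute, so (h+2)/(h+3) in f cancels against (h+3)/(h+2), leaving -h/(h+1),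
  which is also the prefactor of f(E - 1).\<close>

lemma f_scaled: "f * h * (h + 3) * inverse (h + 1) * inverse (h + 2) = - h * inverse (h + 1) * A"
proof -
  have cA: "A * h = h * A" "A * (h + 3) = (h + 3) * A" "A * inverse (h + 1) = inverse (h + 1) * A"
    "A * inverse (h + 2) = inverse (h + 2) * A"
    using E_A by (auto simp flip: commutes_def intro!: commutes_intros commutes_sym[of h A] h_intro)
  have c: "inverse (h + 3) * h = h * inverse (h + 3)" "(h + 2) * h = h * (h + 2)"
    "(h + 2) * inverse (h + 1) = inverse (h + 1) * (h + 2)"
    by (auto simp flip: commutes_def intro!: commutes_intros commutes_add_left h_intro
        E_h commutes_sym[OF commutes_inverse] commutes_numeral_left)
  have "f * h * (h + 3) * inverse (h + 1) * inverse (h + 2)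
      = - ((h + 2) * (inverse (h + 3) * ((A * h) * ((h + 3) * (inverse (h + 1) * inverse (h + 2))))))"
    by (simp only: f_A mult.assoc mult_minus_left)
  also have "\<dots> = - ((h + 2) * (inverse (h + 3) * h * (A * (h + 3) * (inverse (h + 1) * inverse (h + 2)))))"
    by (simp only: cA(1) mult.assoc)
  also have "\<dots> = - ((h + 2) * (h * (inverse (h + 3) * (h + 3)) * (A * inverse (h + 1) * inverse (h + 2))))"
    by (simp only: cA cA[THEN left_commute] c[THEN left_commute] mult.assoc)
  also have "\<dots> = - (((h + 2) * h) * (inverse (h + 1) * (A * inverse (h + 2))))"
    using hk_nz by (simp add: cA mult.assoc)
  also have "\<dots> = - (h * ((h + 2) * inverse (h + 1)) * (inverse (h + 2) * A))"
    by (simp only: cA cA[THEN left_commute] c[THEN left_commute] mult.assoc)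
  also have "\<dots> = - (h * inverse (h + 1) * ((h + 2) * inverse (h + 2)) * A)"
    by (simp only: c mult.assoc)
  finally show ?thesis using hk_nz by simp
qed

text \<open>With t = 2u and h = 2E both sides are 2 u^2 / E.\<close>

lemma t_square: "h * inverse (h + 1) * (u * u * (h + 1) * inverse E * inverse E) = t * t * inverse h"
proof -
  have c: "u * (h + 1) = (h + 1) * u" "h * u = u * h"
    unfolding commutes_def[symmetric]
    by (intro commutes_intros h_intro h_intro[THEN commutes_sym] E_u)+
  have "h * inverse (h + 1) * (u * u * (h + 1) * inverse E * inverse E)
     = h * (inverse (h + 1) * (h + 1)) * (u * u) * inverse E * inverse E"
    by (simp only: c(1)[THEN left_commute] mult.assoc)
  also have "\<dots> = (u * u) * h * inverse E * inverse E"
    using hk_nz by (simp add: c(2) c(2)[THEN left_commute] mult.assoc)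
  also have "\<dots> = u * u * (h * inverse E) * inverse E" by (simp only: mult.assoc)
  also have "h * inverse E = 2" using E_nz by (simp add: h_def mult.assoc)
  finally have 1: "h * inverse (h + 1) * (u * u * (h + 1) * inverse E * inverse E) = u * u * 2 * inverse E" .
  have "t * t = u * u * 2 * 2" by (simp add: t_u mult_2 mult_2_right algebra_simps)
  moreover have "inverse h = inverse 2 * inverse E"
  proof -
    have "h = E * 2" by (simp add: h_def mult_2 mult_2_right)
    then show ?thesis using E_nz numeral_nz by (simp add: nonzero_inverse_mult_distrib)
  qed
  ultimately have "t * t * inverse h = u * u * 2 * (2 * inverse 2) * inverse E"
    by (simp only: mult.assoc)
  then show ?thesis using 1 numeral_nz[of "num.Bit0 num.One"] by simp
qed

text \<open>This is the difference equation imposed by the relation for z_+ z_-. When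
  \<open>A'_A\<close> is multiplied by -h/(h+1), the summand \<open>A\<close> gives the multiple of
  f, -(h+1) gives h, and the last summand gives -t^2/h.\<close>

lemma f_shift: "f_elem n w (E - 1) = f * h * (h + 3) * inverse (h + 1) * inverse (h + 2) - t * t * inverse h + h"
proof -
  have gen: "- h * y * (a - b + c) = - h * y * a - (- h * y * b) + - (h * y * c)" for y a b c
    by (simp add: ring_distribs)
  have "f_elem n w (E - 1) = - h * inverse (h + 1) * A - (- h * inverse (h + 1) * (h + 1))
     + - (h * inverse (h + 1) * (u * u * (h + 1) * inverse E * inverse E))"
    unfolding f_shift_A' A'_A by (rule gen)
  then show ?thesis
    unfolding f_scaled t_square using hk_nz by (simp add: mult.assoc)
qed

lemma h_x: "h * x = x * (h + 2)"
  unfolding h_def by (simp add: mult.assoc E_x) (simp add: mult_2 mult_2_right algebra_simps)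

lemma h_shift: "h * inverse x = inverse x * h - 2 * inverse x"
proof -
  have "inverse x * h * (x * inverse x) = (inverse x * x) * (h + 2) * inverse x"
    using h_x by (metis mult.assoc)
  then have "inverse x * h = (h + 2) * inverse x" using x_nz by simp
  then show ?thesis by (simp add: algebra_simps)
qed

text \<open>Identifies the image of \<open>DR_C1\<close> under the first map.\<close>

lemma t_n: "(h + 2) * t = n" "t * (h + 2) = n"
proof -
  show *: "t * (h + 2) = n" using hk_nz(3) unfolding t_def h_eqs by (metis nonzero_eq_divide_eq)
  have "commutes t (h + 2)"
    using E_t commutes_sym h_intro by (blast intro: commutes_intros)
  then show "(h + 2) * t = n" using * by (simp add: commutes_def)
qed

lemma shift_inverse: "inverse h * x = x * inverse (h + 2)" "inverse (h + 2) * x = x * inverse (h + 4)"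
  "(h + 2) * x = x * (h + 4)"
proof -
  have 1: "inverse a * x = x * inverse b" if "a * x = x * b" "a \<noteq> 0" "b \<noteq> 0" for a b
  proof -
    have "(inverse a * a) * x * inverse b = inverse a * x * (b * inverse b)"
      using that by (metis mult.assoc)
    then show ?thesis using that by simp
  qed
  show 2: "(h + 2) * x = x * (h + 4)"
  proof -
    have "(h + 2) * x = x * (h + 2) + 2 * x" by (simp add: ring_distribs h_x)
    also have "2 * x = x * 2" by (metis mult_2 mult_2_right)
    finally show ?thesis by (simp add: small_numeral_mult algebra_simps)
  qed
  show "inverse h * x = x * inverse (h + 2)" using 1 h_x hk_nz by blast
  show "inverse (h + 2) * x = x * inverse (h + 4)" using 1 2 hk_nz hl_nz[of 4] by simp
qed

text \<open>Only the relation for z_+ z_- depends on the actual form of f. The other relations that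
  contain z_+ follow because f commutes with \<open>n\<close> and E and because pulling x to the
  left raises h by 2.\<close>

theorem DR_relations_hold:
  shows "(x * f) * t = t * (x * f) * (h + 4) * inverse (h + 2)"
    and "(x * f) * inverse x = inverse x * (x * f) * h * (h + 3) * inverse (h + 1) * inverse (h + 2) - t * t * inverse h + h"
    and "t * inverse x = inverse x * t * (h + 2) * inverse h"
    and "h * (x * f) = (x * f) * h + 2 * (x * f)" "h * t = t * h"
    and "h * inverse x = inverse x * h - 2 * inverse x"
proof -
  have h_f: "f * h = h * f" and "t * h = h * t"
    using h_intro[OF E_f] h_intro[OF E_t] by (simp_all add: commutes_def)
  then show "h * t = t * h" by simp
  show "h * inverse x = inverse x * h - 2 * inverse x" by (rule h_shift)
  have "h * (x * f) = x * (h + 2) * f" by (simp add: h_x flip: mult.assoc)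
  also have "\<dots> = x * (f * h) + x * (2 * f)" unfolding h_f by (simp add: algebra_simps)
  also have "\<dots> = (x * f) * h + 2 * (x * f)" by (simp add: mult_2 algebra_simps)
  finally show "h * (x * f) = (x * f) * h + 2 * (x * f)" .
  show "(x * f) * inverse x = inverse x * (x * f) * h * (h + 3) * inverse (h + 1) * inverse (h + 2) - t * t * inverse h + h"
    unfolding conj_f f_shift using x_nz by (simp flip: mult.assoc)
  have t: "t = n * inverse (h + 2)" by (simp add: t_def h_eqs divide_inverse)
  have "t * inverse x = inverse x * (n * inverse h)"
  proof -
    have "t * inverse x = n * (inverse x * (x * inverse (h + 2)) * inverse x)"
      using x_nz by (simp add: t flip: mult.assoc)
    also have "\<dots> = n * inverse x * inverse h"
      unfolding shift_inverse(1)[symmetric] using x_nz by (simp add: mult.assoc)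
    also have "n * inverse x = inverse x * n"
      using commutes_inverse[OF n_x] by (simp add: commutes_def)
    finally show ?thesis by (simp add: mult.assoc)
  qed
  then show "t * inverse x = inverse x * t * (h + 2) * inverse h"
    by (metis t_n(2) mult.assoc)
  have h4: "h + 4 \<noteq> 0" using hl_nz[of 4] by simp
  have "commutes f (inverse (h + 4))"
    by (intro commutes_intros commutes_sym[OF h_intro] E_f)
  then have c: "inverse (h + 4) * f = f * inverse (h + 4)" "f * n = n * f" "n * x = x * n"
    using n_f n_x by (simp_all add: commutes_def)
  \<comment> \<open>Pulling x to the front turns 1/(h+2) into 1/(h+4), which cancels the factor h+4
    of the relation.\<close>
  have "t * (x * f) * (h + 4) * inverse (h + 2) = n * (inverse (h + 2) * x) * f * (h + 4) * inverse (h + 2)"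
    by (simp only: t mult.assoc)
  also have "\<dots> = (n * x) * (inverse (h + 4) * f) * (h + 4) * inverse (h + 2)"
    by (simp only: shift_inverse mult.assoc)
  also have "\<dots> = x * (n * f) * (inverse (h + 4) * (h + 4)) * inverse (h + 2)"
    unfolding c(1,3) by (simp only: mult.assoc)
  also have "\<dots> = x * f * t" unfolding c(2)[symmetric] using h4 by (simp add: t mult.assoc)
  finally show "(x * f) * t = t * (x * f) * (h + 4) * inverse (h + 2)" ..
qed

text \<open>The factor (h+3)/(h+2) cancels the prefactor of f, so the first summand is -A. The other
  two restore u^2 and E(E+2), and only -w survives: this is the origin of the sign between C^{(2)}
  and zeta.\<close>

theorem C2_value: "inverse x * (x * f) * (h + 3) * inverse (h + 2) + t * t * inverse 4 + h * (h + 4) * inverse 4 = - w"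
proof -
  have cA: "A * (h + 3) = (h + 3) * A" "A * inverse (h + 2) = inverse (h + 2) * A"
    using E_A by (auto simp flip: commutes_def intro!: commutes_intros commutes_sym[of h A] h_intro)
  have "inverse x * (x * f) * (h + 3) * inverse (h + 2) = f * (h + 3) * inverse (h + 2)"
    using x_nz by (simp flip: mult.assoc)
  also have "\<dots> = - ((h + 2) * (inverse (h + 3) * (h + 3)) * inverse (h + 2) * A)"
    by (simp only: f_A mult.assoc cA cA[THEN left_commute] mult_minus_left)
  also have "\<dots> = - A" using hk_nz by simp
  finally have 1: "inverse x * (x * f) * (h + 3) * inverse (h + 2) = - A" .
  have "t * t = u * u * 4" by (simp add: t_u small_numeral_mult algebra_simps)
  then have 2: "t * t * inverse 4 = u * u" using numeral_nz by (simp add: mult.assoc)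
  have "h * (h + 4) = E * (E + 2) * 4"
  proof -
    have "4 = (2 + 2 :: 'd)" by simp
    then show ?thesis by (simp add: h_def small_numeral_mult ring_distribs)
  qed
  then have 3: "h * (h + 4) * inverse 4 = E * (E + 2)" using numeral_nz by (simp add: mult.assoc)
  show ?thesis unfolding 1 2 3 A_def by simp
qed

end

subsection \<open>Central elements of \<open>DR\<close>\<close>

locale dr_rep =
  fixes s :: "complex \<Rightarrow> 'd::division_ring" and zp z t h :: 'd
  assumes s: "central_scalars s"
    and h_nz: "h + of_int l \<noteq> 0" and z_nz: "z \<noteq> 0"
    and zp_t: "zp * t = t * zp * (h + 4) * inverse (h + 2)"
    and zp_z: "zp * z = z * zp * h * (h + 3) * inverse (h + 1) * inverse (h + 2) - t * t * inverse h + h"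
    and t_z: "t * z = z * t * (h + 2) * inverse h"
    and h_zp: "h * zp = zp * h + 2 * zp" and h_t: "h * t = t * h" and h_z: "h * z = z * h - 2 * z"
begin

lemmas numeral_nz = central_scalars_numeral_nonzero[OF s]

lemma hk_nz: "h \<noteq> 0" "h + 1 \<noteq> 0" "h + 2 \<noteq> 0" "h + 3 \<noteq> 0"
  using h_nz[of 0] h_nz[of 1] h_nz[of 2] h_nz[of 3] by simp_all

definition C1 where "C1 = (h + 2) * t"
definition P where "P = z * zp"
definition C2 where
  "C2 = z * zp * (h + 3) * inverse (h + 2) + t * t * inverse 4 + h * (h + 4) * inverse 4"
text \<open>With \<open>v\<close>, the counterparts of E and u on the Weyl side.\<close>

definition E where "E = inverse 2 * h"
definition v where "v = inverse 2 * t"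

text \<open>Since z_- plays the role of x^{-1}, this is conjugation by x. Commuting with
  \<open>z\<close> means being a fixed point, and the effect on C^{(1)} and C^{(2)} can be computed
  from the values at \<open>h\<close>, \<open>t\<close> and \<open>P\<close>.\<close>

definition shift where "shift a = inverse z * a * z"

lemma shift_hom: "ring_1_hom shift"
proof -
  have "inverse z \<noteq> 0" using z_nz by simp
  then have "ring_1_hom (\<lambda>a. inverse z * a * inverse (inverse z))" by (rule ring_1_hom_conj)
  moreover have "shift = (\<lambda>a. inverse z * a * inverse (inverse z))"
    using z_nz by (simp add: shift_def fun_eq_iff)
  ultimately show ?thesis by simp
qed

lemma shift_eqI: "a * z = z * b \<Longrightarrow> shift a = b"
  using z_nz by (simp add: shift_def mult.assoc inverse_cancel_left)

lemma shift_eqD: "shift a = a \<Longrightarrow> commutes a z"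
proof -
  assume "shift a = a"
  then have "z * (inverse z * (a * z)) = z * a" by (simp add: shift_def mult.assoc)
  then show ?thesis using z_nz by (simp add: inverse_cancel_left commutes_def)
qed

lemma two: "2 * inverse 2 = (1 :: 'd)" "inverse 2 * 2 = (1 :: 'd)"
  using right_inverse[OF numeral_nz] left_inverse[OF numeral_nz] by blast+

lemma h_E: "h = 2 * E" and t_v: "t = 2 * v"
  unfolding E_def v_def by (rule inverse_cancel_left(1)[OF numeral_nz, symmetric])+

lemma E_nz: "E \<noteq> 0" using hk_nz(1) h_E by (metis mult_zero_right)

lemma h_t_commutes: "commutes h t" "commutes t h"
  using h_t by (simp_all add: commutes_def)

lemma shift_h: "shift h = h - 2"
proof (rule shift_eqI)
  have "z * 2 = 2 * z" by (simp add: mult_2 mult_2_right)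
  then show "h * z = z * (h - 2)" by (simp add: h_z right_diff_distrib)
qed

lemma shift_t: "shift t = t * (h + 2) * inverse h"
  by (rule shift_eqI) (simp add: t_z mult.assoc)

lemma shift_P: "shift P = zp * z"
  by (rule shift_eqI) (simp add: P_def mult.assoc)

lemma half_commutes: "commutes (inverse 2) (a :: 'd)" "commutes a (inverse 2)"
  using commutes_inverse[OF commutes_numeral] commutes_sym by blast+

lemma commutes_E: "commutes a h \<Longrightarrow> commutes a E" and commutes_v: "commutes a t \<Longrightarrow> commutes a v"
  unfolding E_def v_def by (intro commutes_intros; assumption)+

lemma v_E: "commutes v E"
  unfolding v_def by (intro commutes_mult_left half_commutes commutes_E h_t_commutes)

lemma inverse_h: "inverse h = inverse E * inverse 2"
  using nonzero_inverse_mult_distrib[OF numeral_nz E_nz, of "num.Bit0 num.One"]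
  by (simp only: h_E[symmetric])

lemma shift_half: "shift (inverse 2) = inverse 2"
  by (simp only: ring_1_hom_inverse[OF shift_hom] ring_1_hom_numeral[OF shift_hom])

lemma shift_E: "shift E = E - 1"
  by (simp only: E_def ring_1_homD(3)[OF shift_hom] shift_half shift_h right_diff_distrib two)

text \<open>The factor (h+2)/h in the relation between t and z_- is 1 + 1/E.\<close>

lemma shift_v: "shift v = v + v * inverse E"
proof -
  have eq: "(h + 2) * inverse h = 1 + inverse E"
  proof -
    have "2 * inverse E = inverse E * 2"
      using commutes_numeral_left unfolding commutes_def by blast
    then have "2 * inverse h = inverse E * (2 * inverse 2)"
      unfolding inverse_h by (rule left_commute)
    then show ?thesis by (simp only: semiring_class.distrib_right right_inverse[OF hk_nz(1)] two mult_1_right)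
  qed
  have "shift v = inverse 2 * (t * ((h + 2) * inverse h))"
    by (simp only: v_def ring_1_homD(3)[OF shift_hom] shift_half shift_t mult.assoc)
  then show ?thesis unfolding eq by (simp only: v_def mult.assoc ring_distribs mult_1_right)
qed

lemma quarter: "t * t * inverse 4 = v * v" "h * (h + 4) * inverse 4 = E * (E + 2)"
proof -
  have "2 * v * (2 * v) = v * v * 4" by (simp add: small_numeral_mult algebra_simps)
  then have "t * t = v * v * 4" by (simp only: t_v[symmetric])
  then show "t * t * inverse 4 = v * v" using numeral_nz by (simp add: mult.assoc)
  have "4 = (2 + 2 :: 'd)" by simp
  then have "2 * E * (2 * E + 4) = E * (E + 2) * 4" by (simp add: small_numeral_mult ring_distribs)
  then have "h * (h + 4) = E * (E + 2) * 4" by (simp only: h_E[symmetric])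
  then show "h * (h + 4) * inverse 4 = E * (E + 2)" using numeral_nz by (simp add: mult.assoc)
qed

lemma C2_eq: "C2 = P * (h + 3) * inverse (h + 2) + v * v + E * (E + 2)"
  by (simp only: C2_def P_def quarter)

lemma h_inverse_commute:
  "h * (h + 3) = (h + 3) * h" "inverse (h + 1) * inverse (h + 2) = inverse (h + 2) * inverse (h + 1)"
  "h * inverse (h + 2) = inverse (h + 2) * h"
proof -
  have c: "commutes h h" by (simp add: commutes_def)
  show "h * (h + 3) = (h + 3) * h" "h * inverse (h + 2) = inverse (h + 2) * h"
    unfolding commutes_def[symmetric] by (intro commutes_intros c)+
  have "commutes (h + 2) (h + 1)" by (intro commutes_intros commutes_add_left c commutes_numeral_left)
  then have "commutes (inverse (h + 1)) (inverse (h + 2))"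
    using commutes_inverse commutes_sym by blast
  then show "inverse (h + 1) * inverse (h + 2) = inverse (h + 2) * inverse (h + 1)"
    by (simp add: commutes_def)
qed

text \<open>The shift turns (h+3)/(h+2) into (h+1)/h, which cancels h/(h+1) in the relation for z_+
  z_-, so the coefficient of \<open>P\<close> reappears. The terms -t^2/h and h of that relation
  become the two corrections.\<close>

lemma shift_leading: "shift (P * (h + 3) * inverse (h + 2)) =
  P * (h + 3) * inverse (h + 2) - v * v * (h + 1) * inverse E * inverse E + (h + 1)"
proof -
  have "h - 2 + 3 = h + 1" "h - 2 + 2 = h" by (simp_all add: algebra_simps)
  then have "shift (P * (h + 3) * inverse (h + 2)) = zp * z * (h + 1) * inverse h"
    by (simp add: hom_simps[OF shift_hom] ring_1_hom_inverse[OF shift_hom] shift_h shift_P)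
  also have "\<dots> = P * h * (h + 3) * inverse (h + 1) * inverse (h + 2) * (h + 1) * inverse h
      - t * t * inverse h * (h + 1) * inverse h + h * (h + 1) * inverse h"
    unfolding zp_z by (simp only: P_def left_diff_distrib semiring_class.distrib_right[of _ _ "h + 1"]
        semiring_class.distrib_right[of _ _ "inverse h"])
  also have "h * (h + 1) * inverse h = h + 1"
    using hk_nz(1) by (simp add: ring_distribs mult.assoc)
  also have "P * h * (h + 3) * inverse (h + 1) * inverse (h + 2) * (h + 1) * inverse h
     = P * ((h + 3) * (inverse (h + 2) * (h * ((inverse (h + 1) * (h + 1)) * inverse h))))"
    by (simp only: mult.assoc h_inverse_commute h_inverse_commute[THEN left_commute])
  also have "\<dots> = P * (h + 3) * inverse (h + 2)" using hk_nz by (simp add: mult.assoc)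
  also have "t * t * inverse h * (h + 1) * inverse h = v * v * (h + 1) * inverse E * inverse E"
  proof -
    have c: "inverse E * (h + 1) = (h + 1) * inverse E" "a * 2 = 2 * a" "a * inverse 2 = inverse 2 * a" for a :: 'd
      using commutes_inverse[OF commutes_E, of "h + 1"] half_commutes(2)[of a] commutes_numeral[of a]
      by (auto simp: commutes_def ring_distribs)
    have "t * t * inverse h * (h + 1) * inverse h
       = (2 * v) * (2 * v) * (inverse 2 * inverse E) * (h + 1) * (inverse 2 * inverse E)"
      by (simp only: inverse_h t_v[symmetric] c(3))
    also have "\<dots> = v * v * (2 * inverse 2 * (2 * inverse 2)) * (inverse E * (h + 1)) * inverse E"
      by (simp only: mult.assoc inverse_cancel_left[OF numeral_nz] c(2)[of v, THEN left_commute]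
          c(3)[of v, THEN left_commute] c(3)[of "inverse E", THEN left_commute]
          c(3)[of "h + 1", THEN left_commute])
    finally show ?thesis using two by (simp only: c(1) mult_1_right mult.assoc)
  qed
  finally show ?thesis .
qed

text \<open>The corrections of the leading term cancel those produced by v^2 and by E(E+2).\<close>

lemma C2_z: "commutes C2 z"
proof (rule shift_eqD)
  have "E - 1 + 2 = E + 1" by simp
  then have "shift (E * (E + 2)) = (E - 1) * (E + 1)"
    by (simp only: ring_1_homD(2,3)[OF shift_hom] shift_E ring_1_hom_numeral[OF shift_hom])
  moreover have "shift (v * v) = v * v + v * v * (2 * E + 1) * inverse E * inverse E"
    by (simp only: ring_1_homD(3)[OF shift_hom] shift_v shift_square[OF v_E E_nz])
  ultimately have "shift C2 = P * (h + 3) * inverse (h + 2) - v * v * (h + 1) * inverse E * inverse E + (h + 1)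
    + (v * v + v * v * (2 * E + 1) * inverse E * inverse E) + (E - 1) * (E + 1)"
    by (simp only: C2_eq ring_1_homD(2)[OF shift_hom] shift_leading)
  also have "\<dots> = C2"
  proof -
    \<comment> \<open>Here \<open>y\<close> is v^2 (2E+1)/E^2, which occurs once with each sign;
      \<open>c\<close> and the locally bound \<open>z\<close> are h+1 and (E-1)(E+1), with sum
      E(E+2).\<close>
    have gen: "a - y + c + (b + y) + z = a + b + w" if "c + z = w" for a b c w y z :: 'd
      unfolding that[symmetric] by simp
    have "(2 * E + 1) + (E - 1) * (E + 1) = E * (E + 2)"
      by (simp add: small_numeral_mult algebra_simps)
    then have "(h + 1) + (E - 1) * (E + 1) = E * (E + 2)" by (simp only: h_E[symmetric])
    then show ?thesis unfolding C2_eq h_E[symmetric] by (rule gen)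
  qed
  finally show "shift C2 = C2" .
qed

lemma C1_h: "commutes C1 h"
  unfolding C1_def by (intro commutes_mult_left commutes_add_left h_t_commutes commutes_trivial commutes_numeral_left)

text \<open>The shift replaces h+2 by h and t by t (h+2)/h, so the factor h+2 is lost in one place
  and regained in the other.\<close>

lemma C1_z: "commutes C1 z"
proof (rule shift_eqD)
  have "h - 2 + 2 = h" by simp
  then have "shift C1 = h * (t * (h + 2) * inverse h)"
    by (simp add: C1_def hom_simps[OF shift_hom] shift_h shift_t)
  also have "\<dots> = (h + 2) * t"
  proof -
    have "commutes h (t * (h + 2))" by (intro commutes_intros h_t_commutes)
    then have "h * (t * (h + 2) * inverse h) = t * (h + 2) * (h * inverse h)"
      by (metis commutes_def mult.assoc)
    moreover have "commutes t (h + 2)" by (intro commutes_intros h_t_commutes)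
    ultimately show ?thesis using hk_nz by (simp add: commutes_def)
  qed
  finally show "shift C1 = C1" by (simp add: C1_def)
qed

lemma zp_shift: "h * zp = zp * (h + 2)" "(h + 2) * zp = zp * (h + 4)" "inverse h * zp = zp * inverse (h + 2)"
proof -
  have two_zp: "2 * zp = zp * 2" by (simp add: mult_2 mult_2_right)
  show 1: "h * zp = zp * (h + 2)" by (simp add: h_zp two_zp semiring_class.distrib_left)
  have "(h + 2) * zp = zp * (h + 2) + zp * 2" by (simp only: semiring_class.distrib_right 1 two_zp)
  also have "\<dots> = zp * (h + 2 + 2)" by (simp only: semiring_class.distrib_left)
  finally show "(h + 2) * zp = zp * (h + 4)" by (simp add: add.assoc)
  have "inverse h * (h * zp) * inverse (h + 2) = inverse h * (zp * (h + 2)) * inverse (h + 2)"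
    using 1 by simp
  then show "inverse h * zp = zp * inverse (h + 2)"
    by (simp only: inverse_cancel_left(2)[OF hk_nz(1)] mult.assoc right_inverse[OF hk_nz(3)] mult_1_right)
qed

lemma P_h: "commutes h P"
proof -
  have "h * P = z * ((h - 2) * zp)"
  proof -
    have "h * P = (h * z) * zp" by (simp only: P_def mult.assoc)
    also have "h * z = z * (h - 2)" unfolding h_z by (simp add: small_numeral_mult algebra_simps)
    finally show ?thesis by (simp only: mult.assoc)
  qed
  also have "(h - 2) * zp = zp * h" by (simp add: h_zp left_diff_distrib)
  finally show ?thesis by (simp add: commutes_def P_def mult.assoc)
qed

text \<open>Passing z_- costs t the factor (h+2)/h; moved past z_+ this becomes (h+4)/(h+2), exactly
  the factor in the relation for z_+ t.\<close>

lemma P_t: "commutes t P"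
proof -
  have "t * P = (t * z) * zp" by (simp only: P_def mult.assoc)
  also have "\<dots> = z * t * ((h + 2) * (inverse h * zp))" unfolding t_z by (simp only: mult.assoc)
  also have "\<dots> = z * t * zp * (h + 4) * inverse (h + 2)" 
    unfolding zp_shift(3) mult.assoc[symmetric] by (simp only: zp_shift(2) mult.assoc)
  also have "\<dots> = z * (zp * t)" unfolding zp_t by (simp only: mult.assoc)
  finally show ?thesis by (simp add: commutes_def P_def mult.assoc)
qed

lemma C2_h: "commutes h C2" and C2_t: "commutes t C2"
proof -
  have c: "commutes h h" "commutes t t" by (simp_all add: commutes_def)
  show "commutes h C2" "commutes t C2"
    unfolding C2_eq by (intro commutes_intros P_h P_t commutes_E commutes_v h_t_commutes c)+
qed

lemma C1_C2: "commutes C1 C2"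
  unfolding C1_def by (intro commutes_mult_left commutes_add_left commutes_numeral_left C2_h C2_t)

end

lemma DR_hom_C1: "alg_hom DR_scal s \<Phi> \<Longrightarrow> \<Phi> DR_C1 = (\<Phi> DR_h + 2) * \<Phi> DR_t"
  for \<Phi> :: "DR \<Rightarrow> 'd::division_ring"
  unfolding DR_C1_def by (drule alg_homD(1)) (simp add: hom_simps del: distrib_right_numeral)

lemma DR_hom_C2:
  fixes s :: "complex \<Rightarrow> 'd::division_ring"
  assumes "alg_hom DR_scal s \<Phi>" "ring_1_hom s"
  shows "\<Phi> DR_C2 = \<Phi> DR_zm * \<Phi> DR_zp * (\<Phi> DR_h + 3) * inverse (\<Phi> DR_h + 2)
    + \<Phi> DR_t * \<Phi> DR_t * inverse 4 + \<Phi> DR_h * (\<Phi> DR_h + 4) * inverse 4"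
proof -
  have "s (1/4) = inverse 4"
    using ring_1_hom_inverse[OF assms(2), of 4] by (simp add: ring_1_hom_numeral[OF assms(2)] inverse_eq_divide)
  then show ?thesis
    using DR_hom_hinv(2)[OF assms, of 2]
    by (simp only: DR_C2_def hom_simps[OF alg_homD(1)[OF assms(1)]] alg_homD(2)[OF assms(1)]
        power2_eq_square of_int_numeral)
qed

text \<open>Division by h+2 recovers t from C^{(1)}; division by z_- and by (h+3)/(h+2) then
  recovers z_+ from C^{(2)}. Composites can thus be compared without evaluating f.\<close>

lemma DR_hom_eqI_central:
  fixes s :: "complex \<Rightarrow> 'd::division_ring"
  assumes "alg_hom DR_scal s \<Phi>" "alg_hom DR_scal s \<Phi>'" "ring_1_hom s"
    and z: "\<Phi> DR_zm = \<Phi>' DR_zm" "\<Phi> DR_zm \<noteq> 0" and h: "\<Phi> DR_h = \<Phi>' DR_h"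
    and C: "\<Phi> DR_C1 = \<Phi>' DR_C1" "\<Phi> DR_C2 = \<Phi>' DR_C2"
  shows "\<Phi> = \<Phi>'"
proof (rule DR_hom_eqI[OF assms(1-3) _ z(1) _ h])
  have nz: "\<Phi>' DR_h + 2 \<noteq> 0" "\<Phi>' DR_h + 3 \<noteq> 0"
    using DR_hom_hinv(1)[OF assms(2,3), of 2] DR_hom_hinv(1)[OF assms(2,3), of 3] by simp_all
  show t: "\<Phi> DR_t = \<Phi>' DR_t"
    using C(1) nz by (simp add: DR_hom_C1[OF assms(1)] DR_hom_C1[OF assms(2)] h)
  show "\<Phi> DR_zp = \<Phi>' DR_zp"
    using C(2) nz z by (simp add: DR_hom_C2[OF assms(1,3)] DR_hom_C2[OF assms(2,3)] h t)
qed

subsection \<open>Ore sets\<close>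

text \<open>The Ore condition for a single ring element, isolated so that it can be established by
  induction over generators.\<close>

definition ore_elem :: "'r::{ring,monoid_mult} set \<Rightarrow> 'r \<Rightarrow> bool" where
  "ore_elem S a \<longleftrightarrow> (\<forall>s\<in>S. \<exists>b. \<exists>u\<in>S. a * u = s * b)"

locale ore_generation =
  fixes S :: "'r::{ring,monoid_mult} set"
  assumes one: "1 \<in> S" and mult: "s \<in> S \<Longrightarrow> u \<in> S \<Longrightarrow> s * u \<in> S"
    and members: "s \<in> S \<Longrightarrow> ore_elem S s"
begin

text \<open>Treating the summands separately leaves two elements of \<open>S\<close>;
  \<open>members\<close> supplies a common multiple.\<close>

lemma ore_add:
  assumes a: "ore_elem S a" and a': "ore_elem S a'" shows "ore_elem S (a + a')"
  unfolding ore_elem_def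
proof
  fix s assume s: "s \<in> S"
  obtain b u where u: "u \<in> S" "a * u = s * b" using a s unfolding ore_elem_def by blast
  obtain b' u' where u': "u' \<in> S" "a' * u' = s * b'" using a' s unfolding ore_elem_def by blast
  obtain c v where v: "v \<in> S" "u * v = u' * c" using members[OF u(1)] u'(1) unfolding ore_elem_def by blast
  have "a * (u * v) = s * (b * v)" "a' * (u * v) = s * (b' * c)"
    unfolding v(2) using u(2) u'(2) v(2) by (metis mult.assoc)+
  then have "(a + a') * (u * v) = s * (b * v + b' * c)" by (simp add: ring_distribs)
  then show "\<exists>b. \<exists>u\<in>S. (a + a') * u = s * b" using mult u v by blast
qed

lemma ore_mult:
  assumes a: "ore_elem S a" and a': "ore_elem S a'" shows "ore_elem S (a * a')"
  unfolding ore_elem_def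
proof
  fix s assume s: "s \<in> S"
  obtain b u where u: "u \<in> S" "a * u = s * b" using a s unfolding ore_elem_def by blast
  obtain c v where v: "v \<in> S" "a' * v = u * c" using a' u unfolding ore_elem_def by blast
  have "a * a' * v = s * (b * c)" using u(2) v(2) by (metis mult.assoc)
  then show "\<exists>b. \<exists>u\<in>S. a * a' * u = s * b" using v by blast
qed

text \<open>For a generator that is hard to move past the denominators, its product with a
  denominator may be easier. This serves for d, via d x, and for z_+, via z_+ z_-.\<close>

lemma ore_cancel:
  assumes "ore_elem S (a * g)" "g \<in> S" shows "ore_elem S a"
  unfolding ore_elem_def
proof
  fix s assume s: "s \<in> S"
  obtain b u where "u \<in> S" "a * g * u = s * b" using assms s unfolding ore_elem_def by blast
  then show "\<exists>b. \<exists>u\<in>S. a * u = s * b" using mult assms(2) by (metis mult.assoc)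
qed

end

lemma ore_commuting:
  assumes "\<And>s. s \<in> S \<Longrightarrow> \<exists>b. a * s = s * b" shows "ore_elem S a"
  using assms unfolding ore_elem_def by blast

lemma mult_closure_mult: "s \<in> mult_closure G \<Longrightarrow> u \<in> mult_closure G \<Longrightarrow> s * u \<in> mult_closure G"
  by (induction s rule: mult_closure.induct) (simp_all add: mult.assoc mult_closure.intros)

lemma mult_closure_generator: "g \<in> G \<Longrightarrow> g \<in> mult_closure G"
  using mult_closure.mult[OF _ mult_closure.one] by force

lemma mult_closure_nonzero:
  fixes f :: "'r::{ring,monoid_mult} \<Rightarrow> 'd::division_ring"
  assumes "ring_1_hom f" "\<And>g. g \<in> G \<Longrightarrow> f g \<noteq> 0" "s \<in> mult_closure G"
  shows "f s \<noteq> 0"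
  using assms(3) by induction (simp_all add: ring_1_homD[OF assms(1)] assms(2))

lemma mult_closure_commuting:
  assumes "\<And>g. g \<in> G \<Longrightarrow> a * g = g * a" "s \<in> mult_closure G"
  shows "a * s = s * a"
  using assms(2)
proof induction
  case (mult g s)
  then show ?case using assms(1)[of g] by (metis mult.assoc)
qed simp

section \<open>Passage to the skew field of fractions\<close>

lemma skew_field_of_fractionsD:
  assumes "skew_field_of_fractions \<iota>"
  shows "ring_1_hom \<iota>" "inj \<iota>"
  using assms by (auto simp: skew_field_of_fractions_def)

lemma skew_field_of_fractionsE:
  assumes "skew_field_of_fractions \<iota>" obtains a b where "q = \<iota> a / \<iota> b"
  using assms unfolding skew_field_of_fractions_def by blast

lemma ring_1_hom_inverse_numeral:
  fixes s :: "complex \<Rightarrow> 'd::division_ring"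
  assumes "ring_1_hom s" shows "s (1 / numeral k) = inverse (numeral k)"
  using ring_1_hom_inverse[OF assms, of "numeral k"]
  by (simp add: ring_1_hom_numeral[OF assms] inverse_eq_divide)

lemma central_scalars_fractions:
  assumes \<iota>: "skew_field_of_fractions \<iota>" and \<sigma>: "central_scalars \<sigma>"
  shows "central_scalars (\<iota> \<circ> \<sigma>)"
  unfolding central_scalars_def
proof (intro conjI allI)
  note hom = skew_field_of_fractionsD(1)[OF \<iota>]
  show "ring_1_hom (\<iota> \<circ> \<sigma>)"
    using \<sigma> hom by (simp add: central_scalars_def ring_1_hom_comp)
  fix c q
  obtain a b where q: "q = \<iota> a / \<iota> b" by (rule skew_field_of_fractionsE[OF \<iota>])
  have "commutes (\<iota> (\<sigma> c)) (\<iota> a)" for a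
    using \<sigma> by (simp add: commutes_def central_scalars_def flip: ring_1_homD(3)[OF hom])
  then have "commutes (\<iota> (\<sigma> c)) q" unfolding q by (intro commutes_intros)
  then show "(\<iota> \<circ> \<sigma>) c * q = q * (\<iota> \<circ> \<sigma>) c" by (simp add: commutes_def)
qed

text \<open>Injectivity keeps every nonzero denominator nonzero, so all nonzero elements can serve
  as the Ore set. Uniqueness holds because every element is a fraction.\<close>

lemma extension_to_fractions:
  fixes \<iota> :: "'r::{ring,monoid_mult} \<Rightarrow> 'k::division_ring" and f :: "'r \<Rightarrow> 'l::division_ring"
  assumes \<iota>: "skew_field_of_fractions \<iota>" and f: "ring_1_hom f" "inj f"
  obtains F where "ring_1_hom F" "F \<circ> \<iota> = f" "\<And>F'. ring_1_hom F' \<Longrightarrow> F' \<circ> \<iota> = f \<Longrightarrow> F' = F"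
proof -
  interpret right_fractions \<iota> "{s. s \<noteq> 0}" by (rule skew_field_fractions_of_all[OF \<iota>])
  have nz: "s \<in> {s. s \<noteq> 0} \<Longrightarrow> f s \<noteq> 0" for s using inj_hom_nonzero[OF f] by simp
  obtain F where F: "F (\<iota> a) = f a" "F (p + q) = F p + F q" "F (p * q) = F p * F q" for a p q
    using extension_to_localization[OF f(1) nz]
    unfolding skew_field_fractions_of_all(2)[OF \<iota>] hom_on_def by auto
  have "F 1 = 1" using F(1)[of 1] by (simp add: ring_1_homD(1)[OF hom] ring_1_homD(1)[OF f(1)])
  then have F_hom: "ring_1_hom F" using F by (simp add: ring_1_hom_def)
  have "F' = F" if F': "ring_1_hom F'" "F' \<circ> \<iota> = f" for F'
  proof
    fix q
    obtain a b where "q = \<iota> a / \<iota> b" by (rule skew_field_of_fractionsE[OF \<iota>])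
    moreover have "F' (\<iota> a) = F (\<iota> a)" for a using F(1) F'(2) by (auto simp: fun_eq_iff)
    ultimately show "F' q = F q"
      by (simp add: ring_1_hom_divide[OF F'(1)] ring_1_hom_divide[OF F_hom])
  qed
  moreover have "F \<circ> \<iota> = f" using F(1) by auto
  ultimately show ?thesis using that F_hom by blast
qed

section \<open>The denominators in the Weyl algebra form a right Ore set\<close>

locale A12_fractions =
  fixes \<kappa> :: "A12 \<Rightarrow> 'l::division_ring"
  assumes \<kappa>: "skew_field_of_fractions \<kappa>"
begin

lemmas hom = skew_field_of_fractionsD(1)[OF \<kappa>] and inj = skew_field_of_fractionsD(2)[OF \<kappa>]

definition sc where "sc = \<kappa> \<circ> A12_scal"
definition x where "x = \<kappa> A12_x"
definition d where "d = \<kappa> A12_d"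
definition hl :: "int \<Rightarrow> A12" where "hl l = 2 * (A12_x * A12_d) + A12_scal (of_int l)"

lemma sc: "central_scalars sc" "ring_1_hom sc"
  using central_scalars_fractions[OF \<kappa> central_scalars_A12] by (simp_all add: sc_def central_scalars_def)

lemma alg: "alg_hom A12_scal sc \<kappa>" using hom by (simp add: alg_hom_def sc_def)

lemma relations: "d * x = x * d + 1"
  "commutes (\<kappa> A12_nu) (\<kappa> A12_zeta)" "commutes (\<kappa> A12_nu) x" "commutes (\<kappa> A12_nu) d"
  "commutes (\<kappa> A12_zeta) x" "commutes (\<kappa> A12_zeta) d"
  unfolding x_def d_def by (rule A12_hom_relations[OF alg sc(2)])+

lemma eqI: "\<kappa> a = \<kappa> b \<Longrightarrow> a = b" using inj by (rule injD)

lemma hl: "\<kappa> (hl l) = 2 * (x * d) + of_int l"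
  using alg_homD(2)[OF alg] by (simp add: hl_def hom_simps[OF hom] ring_1_hom_of_int[OF sc(2)] x_def d_def)

lemma x_nz: "x \<noteq> 0" using relations(1) by auto

text \<open>Since E x = x (E+1), the element q = 2E + l satisfies q x = x q + 2x, so q = 0 would
  force 2x = 0.\<close>

lemma hl_nz: "2 * (x * d) + of_int l \<noteq> 0"
proof
  assume z: "2 * (x * d) + of_int l = 0"
  have "(2 * (x * d) + of_int l) * x = x * (2 * (x * d) + of_int l) + 2 * x"
    using mult_of_int_commute[of l x]
    by (simp add: ring_distribs relations(1) mult.assoc small_numeral_mult)
  then show False using z x_nz central_scalars_numeral_nonzero[OF sc(1)] by simp
qed

lemma hl_x: "hl l * A12_x = A12_x * hl (l + 2)"
  by (rule eqI, unfold ring_1_homD(3)[OF hom] hl)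
    (use mult_of_int_commute[of l x] relations(1) in \<open>simp add: ring_distribs mult.assoc small_numeral_mult flip: x_def\<close>)

lemma hl_hl: "hl l * hl m = hl m * hl l"
proof (rule eqI)
  have c: "commutes a (2 * (x * d) + of_int k)" if "commutes a (x * d)" for a k
    using that by (intro commutes_add commutes_mult[OF commutes_numeral] commutes_of_int)
  have "commutes (x * d) (x * d)" by (rule commutes_trivial)
  then have "commutes (2 * (x * d) + of_int l) (2 * (x * d) + of_int m)"
    using c commutes_sym by blast
  then show "\<kappa> (hl l * hl m) = \<kappa> (hl m * hl l)"
    by (simp only: ring_1_homD(3)[OF hom] hl commutes_def)
qed

lemma denoms: "A12_denoms = mult_closure ({A12_x} \<union> range hl)"
  by (simp add: A12_denoms_def hl_def[abs_def])

lemma generator_cases: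
  assumes "g \<in> {A12_x} \<union> range hl" obtains "g = A12_x" | l where "g = hl l"
  using assms by auto

lemma x_in: "A12_x \<in> A12_denoms" and hl_in: "hl l \<in> A12_denoms"
  unfolding denoms by (auto intro: mult_closure_generator)

text \<open>Each factor x that is passed raises the index by 2; factors 2E + m leave it
  unchanged.\<close>

lemma hl_past: "u \<in> A12_denoms \<Longrightarrow> \<exists>l'. hl l * u = u * hl l'"
  unfolding denoms
proof (induction u arbitrary: l rule: mult_closure.induct)
  case one
  then show ?case by auto
next
  case (mult g u)
  from mult.hyps(1) show ?case
  proof (cases rule: generator_cases)
    case 1
    then show ?thesis using mult.IH[of "l + 2"] hl_x[of l] by (metis mult.assoc)
  next
    case (2 m)
    then show ?thesis using mult.IH[of l] hl_hl[of l m] by (metis mult.assoc)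
  qed
qed

text \<open>A factor 2E + m moves past x as 2E + m + 2, so the result is again a product of
  generators.\<close>

lemma x_past: "u \<in> A12_denoms \<Longrightarrow> \<exists>v\<in>A12_denoms. A12_x * v = u * A12_x"
  unfolding denoms
proof (induction u rule: mult_closure.induct)
  case one
  then show ?case using mult_closure.one by force
next
  case (mult g u)
  then obtain v where v: "v \<in> mult_closure ({A12_x} \<union> range hl)" "A12_x * v = u * A12_x" by blast
  from mult.hyps(1) show ?case
  proof (cases rule: generator_cases)
    case 1
    then show ?thesis
      using mult_closure_mult[OF mult.hyps(2) x_in[unfolded denoms]] by (metis mult.assoc)
  next
    case (2 m)
    have "g * u * A12_x = A12_x * (hl (m + 2) * v)"
      unfolding 2 using v(2) hl_x[of m] by (metis mult.assoc)
    then show ?thesis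
      using mult_closure_mult[OF hl_in[unfolded denoms] v(1)] by metis
  qed
qed

text \<open>Induction with the second denominator arbitrary: the first generator \<open>g\<close> is
  exchanged with u, and the remaining factor with the denominator v that this produces.\<close>

lemma denoms_ore: "s \<in> A12_denoms \<Longrightarrow> ore_elem A12_denoms s"
proof -
  have "\<forall>u\<in>mult_closure ({A12_x} \<union> range hl). \<exists>c. \<exists>v\<in>mult_closure ({A12_x} \<union> range hl). s * v = u * c"
    if "s \<in> mult_closure ({A12_x} \<union> range hl)" for s
    using that
  proof (induction s rule: mult_closure.induct)
    case one
    then show ?case using mult_closure.one by (metis mult_1_left mult_1_right)
  next
    case (mult g s)
    show ?case
    proof
      fix u assume u: "u \<in> mult_closure ({A12_x} \<union> range hl)"
      have "\<exists>c. \<exists>v\<in>mult_closure ({A12_x} \<union> range hl). g * v = u * c"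
        using mult.hyps(1)
      proof (cases rule: generator_cases)
        case 1
        then show ?thesis using x_past[unfolded denoms] u by metis
      next
        case (2 m)
        then show ?thesis using hl_past[unfolded denoms] u by metis
      qed
      then obtain c v where v: "v \<in> mult_closure ({A12_x} \<union> range hl)" "g * v = u * c" by blast
      then obtain c' v' where v': "v' \<in> mult_closure ({A12_x} \<union> range hl)" "s * v' = v * c'"
        using mult.IH by blast
      have "g * s * v' = u * (c * c')" using v v' by (metis mult.assoc)
      then show "\<exists>c. \<exists>v\<in>mult_closure ({A12_x} \<union> range hl). g * s * v = u * c" using v' by blast
    qed
  qed
  then show "s \<in> A12_denoms \<Longrightarrow> ore_elem A12_denoms s"
    unfolding ore_elem_def denoms by blast
qed

sublocale ore: ore_generation A12_denoms
  by unfold_locales (use denoms_ore in \<open>auto simp: denoms mult_closure.one mult_closure_mult\<close>)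

lemma denoms_nz: "s \<in> A12_denoms \<Longrightarrow> \<kappa> s \<noteq> 0"
  unfolding denoms by (rule mult_closure_nonzero[OF hom]) (auto simp: hl hl_nz x_nz simp flip: x_def)

lemma ore_central:
  assumes "commutes (\<kappa> a) x" "commutes (\<kappa> a) d" shows "ore_elem A12_denoms a"
proof (rule ore_commuting)
  fix s assume s: "s \<in> A12_denoms"
  have "a * g = g * a" if "g \<in> {A12_x} \<union> range hl" for g
  proof (rule eqI)
    have "commutes (\<kappa> a) (\<kappa> g)"
      using that by (cases rule: generator_cases) (use assms in \<open>auto simp: hl x_def intro!: commutes_intros\<close>)
    then show "\<kappa> (a * g) = \<kappa> (g * a)" by (simp add: commutes_def ring_1_homD[OF hom])
  qed
  then have "a * s = s * a" using mult_closure_commuting s unfolding denoms by blast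
  then show "\<exists>b. a * s = s * b" by blast
qed

lemma ore_all: "ore_elem A12_denoms a"
proof (induction a rule: A12_induct)
  case (scal c)
  show ?case
    by (rule ore_central) (use central_scalars_commutes(1)[OF sc(1), of c] in \<open>simp_all add: sc_def\<close>)
next
  case x
  show ?case by (rule denoms_ore[OF x_in])
next
  case d
  \<comment> \<open>The generator d is neither central nor a denominator, but d x = E + 1 = (2E+2)/2
    is a scalar times a denominator, and \<open>ore_cancel\<close> removes x.\<close>
  have "A12_d * A12_x = A12_scal (1/2) * hl 2"
  proof (rule eqI)
    have "\<kappa> (hl 2) = 2 * (d * x)" unfolding hl by (simp add: relations(1) ring_distribs)
    moreover have "\<kappa> (A12_scal (1/2)) = inverse 2"
      using alg_homD(2)[OF alg] ring_1_hom_inverse_numeral[OF sc(2)] by simp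
    ultimately show "\<kappa> (A12_d * A12_x) = \<kappa> (A12_scal (1/2) * hl 2)"
      by (simp only: ring_1_homD(3)[OF hom] x_def[symmetric] d_def[symmetric]
          inverse_cancel_left(2)[OF central_scalars_numeral_nonzero[OF sc(1)]])
  qed
  moreover have "ore_elem A12_denoms (A12_scal (1/2))"
    by (rule ore_central) (use central_scalars_commutes(1)[OF sc(1), of "1/2"] in \<open>simp_all add: sc_def\<close>)
  ultimately have "ore_elem A12_denoms (A12_d * A12_x)"
    using ore.ore_mult denoms_ore[OF hl_in] by metis
  then show ?case using ore.ore_cancel x_in by blast
next
  case nu
  show ?case by (rule ore_central) (rule relations)+
next
  case zeta
  show ?case by (rule ore_central) (rule relations)+
qed (simp_all add: ore.ore_add ore.ore_mult)

theorem ore_set: "right_ore_set A12_denoms"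
  using ore_all ore.one ore.mult denoms_nz ring_1_hom_zero[OF hom]
  unfolding right_ore_set_def ore_elem_def by metis

sublocale frac: right_fractions \<kappa> A12_denoms
  by unfold_locales (rule hom inj ore_set)+

end

section \<open>The first map, into the localization of the Weyl algebra\<close>

context A12_fractions
begin

lemma weyl: "weyl_rep sc x d (sc a * \<kappa> A12_nu) (sc b * \<kappa> A12_zeta)"
proof -
  note c = central_scalars_commutes[OF sc(1)]
  show ?thesis
    by unfold_locales (use sc(1) relations x_nz hl_nz c in
      \<open>auto intro!: commutes_mult_left commutes_mult\<close>)
qed

lemma localization_intros:
  "\<kappa> y \<in> localization \<kappa> A12_denoms"
  "sc c \<in> localization \<kappa> A12_denoms"
  "numeral k \<in> localization \<kappa> A12_denoms"
  "inverse (2 * (x * d) + of_int l) \<in> localization \<kappa> A12_denoms"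
  "inverse x \<in> localization \<kappa> A12_denoms"
  "x \<in> localization \<kappa> A12_denoms" "d \<in> localization \<kappa> A12_denoms"
  "p \<in> localization \<kappa> A12_denoms \<Longrightarrow> q \<in> localization \<kappa> A12_denoms \<Longrightarrow> p + q \<in> localization \<kappa> A12_denoms"
  "p \<in> localization \<kappa> A12_denoms \<Longrightarrow> q \<in> localization \<kappa> A12_denoms \<Longrightarrow> p * q \<in> localization \<kappa> A12_denoms"
  "p \<in> localization \<kappa> A12_denoms \<Longrightarrow> - p \<in> localization \<kappa> A12_denoms"
proof -
  note loc = frac.image_in_localization frac.add_in_localization frac.mult_in_localization
  show "\<kappa> y \<in> localization \<kappa> A12_denoms" for y by (rule loc)
  show sc_in: "sc c \<in> localization \<kappa> A12_denoms" for c unfolding sc_def comp_def by (rule loc)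
  show "numeral k \<in> localization \<kappa> A12_denoms"
    using sc_in[of "numeral k"] by (simp only: ring_1_hom_numeral[OF sc(2)])
  show "inverse (2 * (x * d) + of_int l) \<in> localization \<kappa> A12_denoms"
    unfolding hl[symmetric] by (rule frac.inverse_in_localization[OF hl_in])
  show "inverse x \<in> localization \<kappa> A12_denoms"
    unfolding x_def by (rule frac.inverse_in_localization[OF x_in])
  show "x \<in> localization \<kappa> A12_denoms" "d \<in> localization \<kappa> A12_denoms"
    unfolding x_def d_def by (rule loc)+
  show "p + q \<in> localization \<kappa> A12_denoms" "p * q \<in> localization \<kappa> A12_denoms"
    if "p \<in> localization \<kappa> A12_denoms" "q \<in> localization \<kappa> A12_denoms" for p q
    using that by (rule loc)+
  show "- p \<in> localization \<kappa> A12_denoms" if "p \<in> localization \<kappa> A12_denoms" for p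
  proof -
    have "- p = sc (-1) * p" by (simp add: hom_simps[OF sc(2)])
    then show ?thesis using loc(3)[OF sc_in that] by simp
  qed
qed

lemma DR_to_A12_exists:
  "\<exists>\<Phi>. DR_to_A12 \<kappa> (sc a * \<kappa> A12_nu) (sc b * \<kappa> A12_zeta) \<Phi>"
proof -
  let ?n = "sc a * \<kappa> A12_nu" and ?w = "sc b * \<kappa> A12_zeta" and ?L = "localization \<kappa> A12_denoms"
  interpret W: weyl_rep sc x d ?n ?w by (rule weyl)
  have hW: "W.h = 2 * (x * d)" and EW: "W.E = x * d" by (simp_all only: W.h_def W.E_def)
  obtain \<Phi> where \<Phi>: "alg_hom DR_scal sc \<Phi>" "\<Phi> DR_zp = x * W.f" "\<Phi> DR_zm = inverse x"
    "\<Phi> DR_t = W.t" "\<Phi> DR_h = W.h"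
    by (rule DR_lift[OF sc(1) W.hl_nz W.DR_relations_hold])
  have n_in: "?n \<in> ?L" and w_in: "?w \<in> ?L"
    by (intro localization_intros)+
  have h_in: "W.h \<in> ?L" and E_in: "W.E \<in> ?L"
    unfolding hW EW by (intro localization_intros)+
  have hinv_in: "inverse (W.h + of_int l) \<in> ?L" for l
    unfolding hW by (intro localization_intros)
  have t_in: "W.t \<in> ?L"
    unfolding W.t_def W.h_eqs(1)[symmetric] divide_inverse
    using hinv_in[of 2] n_in localization_intros(9) by simp
  \<comment> \<open>Membership of f is read off from \<open>f_A\<close>, whose denominators are h+3
    and, through u = t/2, h+2.\<close>
  have "W.u = sc (1/2) * W.t"
    unfolding W.t_u ring_1_hom_inverse_numeral[OF sc(2)]
    by (simp only: inverse_cancel_left[OF W.numeral_nz])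
  then have u_in: "W.u \<in> ?L" using t_in localization_intros(2,9) by simp
  have f_in: "W.f \<in> ?L"
    unfolding W.f_A W.A_def using hinv_in[of 3]
    by (intro localization_intros h_in E_in u_in w_in) simp_all
  have "\<Phi> a \<in> ?L" for a
  proof (induction a rule: DR_induct)
    case (scal c)
    then show ?case using alg_homD(2)[OF \<Phi>(1)] localization_intros(2) by simp
  next
    case (hinv l)
    then show ?case using DR_hom_hinv(2)[OF \<Phi>(1) sc(2)] hinv_in \<Phi>(5) by simp
  next
    case zp
    then show ?case unfolding \<Phi> by (intro localization_intros f_in)
  next
    case zm
    then show ?case unfolding \<Phi> by (intro localization_intros)
  qed (simp_all only: \<Phi> t_in h_in ring_1_homD[OF alg_homD(1)[OF \<Phi>(1)]] localization_intros(8,9))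
  then have "DR_to_A12 \<kappa> ?n ?w \<Phi>"
    unfolding DR_to_A12_def Let_def x_def[symmetric] d_def[symmetric] sc_def[symmetric] W.E_def[symmetric]
    using \<Phi> by (auto simp: W.f_def W.t_def W.h_def)
  then show ?thesis by blast
qed

lemma DR_to_A12D:
  assumes "DR_to_A12 \<kappa> n w \<Phi>"
  shows "alg_hom DR_scal sc \<Phi>" "range \<Phi> \<subseteq> localization \<kappa> A12_denoms"
    "\<Phi> DR_zm = inverse x" "\<Phi> DR_t = n / (2 * (x * d + 1))" "\<Phi> DR_zp = x * f_elem n w (x * d)"
    "\<Phi> DR_h = 2 * (x * d)"
  using assms by (auto simp: DR_to_A12_def Let_def x_def d_def sc_def)

lemma DR_to_A12_unique:
  "\<exists>!\<Phi>. DR_to_A12 \<kappa> (sc a * \<kappa> A12_nu) (sc b * \<kappa> A12_zeta) \<Phi>"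
proof -
  have "\<Phi> = \<Phi>'" if "DR_to_A12 \<kappa> n w \<Phi>" "DR_to_A12 \<kappa> n w \<Phi>'" for n w \<Phi> \<Phi>'
    using DR_to_A12D[OF that(1)] DR_to_A12D[OF that(2)] by (intro DR_hom_eqI[OF _ _ sc(2)]) simp_all
  then show ?thesis using DR_to_A12_exists by blast
qed

text \<open>These values determine which multiples of C^{(1)} and C^{(2)} the second map must use to
  be inverse to the first.\<close>

lemma DR_to_A12_central:
  assumes "DR_to_A12 \<kappa> (sc a * \<kappa> A12_nu) (sc b * \<kappa> A12_zeta) \<Phi>"
  shows "\<Phi> DR_C1 = sc a * \<kappa> A12_nu" "\<Phi> DR_C2 = - (sc b * \<kappa> A12_zeta)"
proof -
  note \<Phi> = DR_to_A12D[OF assms]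
  interpret W: weyl_rep sc x d "sc a * \<kappa> A12_nu" "sc b * \<kappa> A12_zeta" by (rule weyl)
  have eqs: "\<Phi> DR_zp = x * W.f" "\<Phi> DR_t = W.t" "\<Phi> DR_h = W.h"
    using \<Phi> by (simp_all only: W.f_def W.t_def W.h_def W.E_def)
  show "\<Phi> DR_C1 = sc a * \<kappa> A12_nu"
    by (simp only: DR_hom_C1[OF \<Phi>(1)] eqs W.t_n)
  show "\<Phi> DR_C2 = - (sc b * \<kappa> A12_zeta)"
    by (simp only: DR_hom_C2[OF \<Phi>(1) sc(2)] eqs \<Phi>(3) W.C2_value)
qed

end

section \<open>The powers of z_- form a right Ore set\<close>

locale DR_A12_fractions = A12_fractions \<kappa>
  for \<kappa> :: "A12 \<Rightarrow> 'l::division_ring" +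
  fixes \<iota> :: "DR \<Rightarrow> 'k::division_ring"
  assumes \<iota>: "skew_field_of_fractions \<iota>"
begin

lemmas DR_hom = skew_field_of_fractionsD(1)[OF \<iota>] and DR_inj = skew_field_of_fractionsD(2)[OF \<iota>]

definition sk where "sk = \<iota> \<circ> DR_scal"
definition z where "z = \<iota> DR_zm"
definition h where "h = \<iota> DR_h"

lemma sk: "central_scalars sk" "ring_1_hom sk"
  using central_scalars_fractions[OF \<iota> central_scalars_DR] by (simp_all add: sk_def central_scalars_def)

lemma DR_alg: "alg_hom DR_scal sk \<iota>" using DR_hom by (simp add: alg_hom_def sk_def)

lemma DR_eqI: "\<iota> a = \<iota> b \<Longrightarrow> a = b" using DR_inj by (rule injD)

text \<open>Nontriviality of \<open>z\<^sub>-\<close> is not visible from the presentation; it is read off the representation of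
  \<open>DR\<close> in the fractions of \<open>A12\<close>.\<close>

lemma z_nz: "z \<noteq> 0"
proof
  assume "z = 0"
  then have "\<iota> DR_zm = \<iota> 0" by (simp add: z_def ring_1_hom_zero[OF DR_hom])
  then have "DR_zm = 0" by (rule DR_eqI)
  moreover obtain \<Phi> where "DR_to_A12 \<kappa> (sc 1 * \<kappa> A12_nu) (sc 1 * \<kappa> A12_zeta) \<Phi>"
    using DR_to_A12_exists by blast
  note \<Phi> = DR_to_A12D[OF this]
  ultimately show False
    using \<Phi>(3) ring_1_hom_zero[OF alg_homD(1)[OF \<Phi>(1)]] x_nz by simp
qed

lemmas DR_rels = DR_hom_relations[OF DR_alg sk(2) HOL.refl z_def HOL.refl h_def]

sublocale D: dr_rep sk "\<iota> DR_zp" z "\<iota> DR_t" h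
  by unfold_locales (use sk(1) DR_rels z_nz DR_hom_hinv(1)[OF DR_alg sk(2)] in \<open>auto simp: h_def\<close>)

lemma hinv: "\<iota> (DR_hinv l) = inverse (h + of_int l)"
  unfolding h_def by (rule DR_hom_hinv(2)[OF DR_alg sk(2)])

lemma C1: "\<iota> DR_C1 = D.C1" and C2: "\<iota> DR_C2 = D.C2"
  by (simp_all only: DR_hom_C1[OF DR_alg] DR_hom_C2[OF DR_alg sk(2)] D.C1_def D.C2_def h_def[symmetric] z_def[symmetric])

lemma zm_powers_commute: "s \<in> DR_denoms \<Longrightarrow> DR_zm * s = s * DR_zm"
  unfolding DR_denoms_def by (rule mult_closure_commuting[of "{DR_zm}"]) auto

sublocale dr_ore: ore_generation DR_denoms
proof
  show "s * u \<in> DR_denoms" if "s \<in> DR_denoms" "u \<in> DR_denoms" for s u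
    using that unfolding DR_denoms_def by (rule mult_closure_mult)
  show "1 \<in> DR_denoms" by (simp add: DR_denoms_def mult_closure.one)
  fix s assume s: "s \<in> DR_denoms"
  have "s * u = u * s" if "u \<in> DR_denoms" for u
    by (rule mult_closure_commuting[of "{DR_zm}"])
      (use that zm_powers_commute[OF s] in \<open>auto simp: DR_denoms_def\<close>)
  then show "ore_elem DR_denoms s" by (intro ore_commuting) blast
qed

lemma zm_in: "DR_zm \<in> DR_denoms"
  unfolding DR_denoms_def by (rule mult_closure_generator) simp

lemma DR_denoms_nz: "s \<in> DR_denoms \<Longrightarrow> \<iota> s \<noteq> 0"
  unfolding DR_denoms_def by (rule mult_closure_nonzero[OF DR_hom]) (use z_nz in \<open>auto simp: z_def\<close>)

lemma dr_ore_commuting: "commutes (\<iota> a) z \<Longrightarrow> ore_elem DR_denoms a"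
proof (rule ore_commuting)
  fix s assume "commutes (\<iota> a) z" and s: "s \<in> DR_denoms"
  then have c: "a * DR_zm = DR_zm * a"
    by (intro DR_eqI) (simp add: ring_1_homD[OF DR_hom] commutes_def z_def)
  have "a * s = s * a"
    by (rule mult_closure_commuting[of "{DR_zm}"]) (use s c in \<open>auto simp: DR_denoms_def\<close>)
  then show "\<exists>b. a * s = s * b" by blast
qed

lemma dr_ore_scal: "ore_elem DR_denoms (DR_scal c)"
  by (rule dr_ore_commuting) (use central_scalars_commutes(1)[OF sk(1), of c] in \<open>simp add: sk_def\<close>)

text \<open>Each factor z_- that is passed lowers the index by 2.\<close>

lemma h_past: "u \<in> DR_denoms \<Longrightarrow> \<exists>l'. (DR_h + DR_scal (of_int l)) * u = u * (DR_h + DR_scal (of_int l'))"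
  unfolding DR_denoms_def
proof (induction u arbitrary: l rule: mult_closure.induct)
  case one
  then show ?case by auto
next
  case (mult g u)
  have "(DR_h + DR_scal (of_int l)) * DR_zm = DR_zm * (DR_h + DR_scal (of_int (l - 2)))"
  proof (rule DR_eqI)
    have "(h + of_int l) * z = z * (h + of_int (l - 2))"
      using mult_of_int_commute[of l z] by (simp add: ring_distribs D.h_z small_numeral_mult)
    then show "\<iota> ((DR_h + DR_scal (of_int l)) * DR_zm) = \<iota> (DR_zm * (DR_h + DR_scal (of_int (l - 2))))"
      by (simp only: ring_1_homD[OF DR_hom] alg_homD(2)[OF DR_alg] ring_1_hom_of_int[OF sk(2)]
          h_def[symmetric] z_def[symmetric])
  qed
  then show ?case using mult.hyps(1) mult.IH[of "l - 2"] by (metis mult.assoc singletonD)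
qed

text \<open>Multiplying the exchange rule for h + l by the inverses of the two shifted elements, one
  on each side, gives the rule for the inverses.\<close>

lemma hinv_past:
  assumes "u \<in> DR_denoms" shows "\<exists>l'. DR_hinv l * u = u * DR_hinv l'"
proof -
  obtain l' where "(DR_h + DR_scal (of_int l)) * u = u * (DR_h + DR_scal (of_int l'))"
    using h_past[OF assms] by blast
  then have "DR_hinv l * ((DR_h + DR_scal (of_int l)) * u) * DR_hinv l'
      = DR_hinv l * (u * (DR_h + DR_scal (of_int l'))) * DR_hinv l'" by simp
  then have "(DR_hinv l * (DR_h + DR_scal (of_int l))) * u * DR_hinv l'
      = DR_hinv l * u * ((DR_h + DR_scal (of_int l')) * DR_hinv l')" by (simp only: mult.assoc)
  then show ?thesis unfolding DR_relations(1,2) by (metis mult_1_left mult_1_right)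
qed

lemma dr_ore_h: "ore_elem DR_denoms DR_h" and dr_ore_hinv: "ore_elem DR_denoms (DR_hinv l)"
proof -
  have "DR_scal (of_int 0) = 0"
    using central_scalars_DR ring_1_hom_zero[of DR_scal] by (simp add: central_scalars_def)
  then show "ore_elem DR_denoms DR_h"
    by (intro ore_commuting) (use h_past[of _ 0] in fastforce)
  show "ore_elem DR_denoms (DR_hinv l)"
    by (intro ore_commuting) (use hinv_past in blast)
qed

text \<open>Both factors of t = (h+2)^{-1} C^{(1)} are under control, since C^{(1)} commutes with
  z_-.\<close>

lemma dr_ore_t: "ore_elem DR_denoms DR_t"
proof -
  have "DR_t = DR_hinv 2 * DR_C1"
    by (rule DR_eqI)
      (simp add: ring_1_homD[OF DR_hom] hinv C1 D.C1_def inverse_cancel_left[OF D.hk_nz(3)])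
  moreover have "ore_elem DR_denoms DR_C1"
    by (rule dr_ore_commuting) (simp add: C1 D.C1_z)
  ultimately show ?thesis using dr_ore_hinv dr_ore.ore_mult by metis
qed

text \<open>The element \<open>z\<^sub>- z\<^sub>+\<close> is a combination of \<open>C\<^sup>2\<close>, \<open>t\<close> and \<open>h\<close>, and the second
  defining relation expresses \<open>z\<^sub>+ z\<^sub>-\<close> by it.\<close>

lemma dr_ore_zp: "ore_elem DR_denoms DR_zp"
proof -
  note intros = dr_ore.ore_add dr_ore.ore_mult dr_ore_scal dr_ore_h dr_ore_hinv dr_ore_t
  have "ore_elem DR_denoms DR_C2"
    by (rule dr_ore_commuting) (simp add: C2 D.C2_z)
  then have 1: "ore_elem DR_denoms ((DR_C2 + DR_scal (-1) * (DR_t * DR_t * DR_scal (1/4)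
      + DR_h * (DR_h + DR_scal 4) * DR_scal (1/4))) * (DR_h + DR_scal 2) * DR_hinv 3)"
    by (intro intros)
  have "\<iota> (DR_zm * DR_zp) = (D.C2 - (\<iota> DR_t * \<iota> DR_t * inverse 4 + h * (h + 4) * inverse 4)) * (h + 2) * inverse (h + 3)"
  proof -
    have eq: "D.C2 - (\<iota> DR_t * \<iota> DR_t * inverse 4 + h * (h + 4) * inverse 4) = D.P * (h + 3) * inverse (h + 2)"
      unfolding D.C2_def D.P_def by (simp only: add.assoc add_diff_cancel_right')
    show ?thesis
      unfolding eq by (simp only: D.P_def mult.assoc inverse_cancel_left(2)[OF D.hk_nz(3)]
          right_inverse[OF D.hk_nz(4)] mult_1_right ring_1_homD(3)[OF DR_hom] z_def[symmetric])
  qed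
  also have "\<dots> = \<iota> ((DR_C2 + DR_scal (-1) * (DR_t * DR_t * DR_scal (1/4)
      + DR_h * (DR_h + DR_scal 4) * DR_scal (1/4))) * (DR_h + DR_scal 2) * DR_hinv 3)"
  proof -
    have "sk (-1) = -1" "sk 4 = 4" "sk 2 = 2" by (simp_all add: hom_simps[OF sk(2)])
    then show ?thesis
      by (simp add: ring_1_homD[OF DR_hom] alg_homD(2)[OF DR_alg] hinv C2 ring_1_hom_inverse_numeral[OF sk(2)]
          flip: h_def)
  qed
  finally have zz: "ore_elem DR_denoms (DR_zm * DR_zp)" using 1 DR_eqI by metis
  have "ore_elem DR_denoms (DR_zp * DR_zm)"
    unfolding DR_relations(4) by (intro intros zz)
  then show ?thesis using dr_ore.ore_cancel zm_in by blast
qed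

theorem DR_ore_set: "right_ore_set DR_denoms"
proof -
  have "ore_elem DR_denoms a" for a
    by (induction a rule: DR_induct)
      (simp_all add: dr_ore_scal dr_ore_h dr_ore_hinv dr_ore_t dr_ore_zp dr_ore.ore_add dr_ore.ore_mult
        dr_ore.members zm_in)
  then show ?thesis
    using dr_ore.one dr_ore.mult DR_denoms_nz ring_1_hom_zero[OF DR_hom]
    unfolding right_ore_set_def ore_elem_def by metis
qed

sublocale dr_frac: right_fractions \<iota> DR_denoms
  by unfold_locales (rule DR_hom DR_inj DR_ore_set)+

end

lemma hom_on_inverse:
  fixes F :: "'a::division_ring \<Rightarrow> 'b::division_ring"
  assumes "hom_on A F" "q \<in> A" "inverse q \<in> A" "q \<noteq> 0" "F 1 = 1"
  shows "F (inverse q) = inverse (F q)"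
proof -
  have "F q * F (inverse q) = F (q * inverse q)" using assms by (simp only: hom_on_def)
  then have "F q * F (inverse q) = 1" using assms(4,5) by simp
  then show ?thesis by (rule inverse_unique[symmetric])
qed

lemma alg_hom_comp:
  assumes g: "alg_hom s s' g" and F: "hom_on A F" "range g \<subseteq> A" "F 1 = 1" "\<And>c. F (s' c) = s'' c"
  shows "alg_hom s s'' (F \<circ> g)"
proof -
  have "g a \<in> A" for a using F(2) by blast
  then show ?thesis
    using g F(1,3,4) by (simp add: alg_hom_def ring_1_hom_def hom_on_def)
qed

section \<open>The second map, into the localization of the reduction algebra\<close>

context DR_A12_fractions
begin

lemma A12_to_DRD:
  assumes "A12_to_DR \<iota> c1 c2 \<Psi>"
  shows "alg_hom A12_scal sk \<Psi>" "range \<Psi> \<subseteq> localization \<iota> DR_denoms" "\<Psi> A12_x = inverse z"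
    "\<Psi> A12_d = inverse 2 * z * h" "\<Psi> A12_nu = c1" "\<Psi> A12_zeta = c2"
  using assms by (simp_all add: A12_to_DR_def sk_def z_def h_def inverse_eq_divide)

lemma z_h: "z * h = (h + 2) * z"
  by (simp add: ring_distribs D.h_z)

lemma half_h: "inverse z * (inverse 2 * z * h) = inverse 2 * h"
proof -
  have c: "inverse 2 * z = z * inverse 2" using D.half_commutes(1) by (simp only: commutes_def)
  show ?thesis unfolding c by (simp only: mult.assoc inverse_cancel_left(2)[OF z_nz])
qed

lemma A12_to_DR_exists: "\<exists>\<Psi>. A12_to_DR \<iota> (sk a * \<iota> DR_C1) (sk b * \<iota> DR_C2) \<Psi>"
proof -
  let ?c1 = "sk a * D.C1" and ?c2 = "sk b * D.C2"
  \<comment> \<open>Since z h z^{-1} = h + 2, half of it exceeds h/2, the image of x d, by exactly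
    1.\<close>
  have weyl: "inverse 2 * z * h * inverse z = inverse z * (inverse 2 * z * h) + 1"
  proof -
    have "inverse 2 * z * h * inverse z = inverse 2 * (z * h) * inverse z" by (simp only: mult.assoc)
    also have "\<dots> = inverse 2 * h + 1"
      unfolding z_h by (simp only: mult.assoc right_inverse[OF z_nz] mult_1_right ring_distribs D.two)
    finally show ?thesis by (simp only: half_h)
  qed
  have c1: "commutes ?c1 z" "commutes ?c1 h" and c2: "commutes ?c2 z" "commutes ?c2 h"
    by (intro commutes_mult_left central_scalars_commutes(1)[OF sk(1)] D.C1_z D.C1_h D.C2_z
        commutes_sym[OF D.C2_h])+
  have cc: "commutes ?c1 ?c2"
    by (intro commutes_mult_left commutes_mult central_scalars_commutes[OF sk(1)] D.C1_C2)
  obtain \<Psi> where \<Psi>: "alg_hom A12_scal sk \<Psi>" "\<Psi> A12_x = inverse z" "\<Psi> A12_d = inverse 2 * z * h"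
    "\<Psi> A12_nu = ?c1" "\<Psi> A12_zeta = ?c2"
    by (rule A12_lift[OF sk(1) weyl cc])
      (use c1 c2 in \<open>auto intro!: commutes_mult commutes_inverse commutes_numeral simp del: inverse_eq_divide_numeral\<close>)
  let ?L = "localization \<iota> DR_denoms"
  note loc = dr_frac.image_in_localization dr_frac.add_in_localization dr_frac.mult_in_localization
  have sk_in: "sk c \<in> ?L" for c unfolding sk_def comp_def by (rule loc)
  have "\<Psi> q \<in> ?L" for q
  proof (induction q rule: A12_induct)
    case (scal c)
    then show ?case using alg_homD(2)[OF \<Psi>(1)] sk_in by simp
  next
    case x
    then show ?case unfolding \<Psi> z_def by (rule dr_frac.inverse_in_localization[OF zm_in])
  next
    case d
    have "inverse 2 * z * h = \<iota> (DR_scal (1/2) * DR_zm * DR_h)"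
      by (simp only: ring_1_homD(3)[OF DR_hom] alg_homD(2)[OF DR_alg] ring_1_hom_inverse_numeral[OF sk(2)] z_def h_def)
    then show ?case unfolding \<Psi> using loc(1) by simp
  next
    case nu
    then show ?case unfolding \<Psi> C1[symmetric] by (intro loc sk_in)
  next
    case zeta
    then show ?case unfolding \<Psi> C2[symmetric] by (intro loc sk_in)
  qed (simp_all only: ring_1_homD[OF alg_homD(1)[OF \<Psi>(1)]] loc)
  then have "A12_to_DR \<iota> (sk a * \<iota> DR_C1) (sk b * \<iota> DR_C2) \<Psi>"
    using \<Psi> by (auto simp: A12_to_DR_def sk_def z_def h_def inverse_eq_divide C1 C2)
  then show ?thesis by blast
qed

lemma A12_to_DR_unique: "\<exists>!\<Psi>. A12_to_DR \<iota> (sk a * \<iota> DR_C1) (sk b * \<iota> DR_C2) \<Psi>"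
proof -
  have "\<Psi> = \<Psi>'" if "A12_to_DR \<iota> c1 c2 \<Psi>" "A12_to_DR \<iota> c1 c2 \<Psi>'" for c1 c2 \<Psi> \<Psi>'
    using A12_to_DRD[OF that(1)] A12_to_DRD[OF that(2)] by (intro A12_hom_eqI[of sk]) simp_all
  then show ?thesis using A12_to_DR_exists by blast
qed

end

subsection \<open>The extensions to the fields of fractions\<close>

text \<open>The condition \<open>scaling\<close> compensates the values a nu of C^{(1)} and -b zeta
  of C^{(2)}. The theorem uses (a, b, a', b') = (1, 1, 1, -1) and (1/2, -1, 2, 1).\<close>

locale mutually_inverse = DR_A12_fractions \<kappa> \<iota>
  for \<kappa> :: "A12 \<Rightarrow> 'l::division_ring" and \<iota> :: "DR \<Rightarrow> 'k::division_ring" +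
  fixes a b a' b' :: complex and \<Phi> :: "DR \<Rightarrow> 'l" and \<Psi> :: "A12 \<Rightarrow> 'k"
  assumes \<Phi>: "DR_to_A12 \<kappa> (sc a * \<kappa> A12_nu) (sc b * \<kappa> A12_zeta) \<Phi>"
    and \<Psi>: "A12_to_DR \<iota> (sk a' * \<iota> DR_C1) (sk b' * \<iota> DR_C2) \<Psi>"
    and scaling: "a * a' = 1" "b * b' = -1"
begin

lemmas \<Phi>D = DR_to_A12D[OF \<Phi>] and \<Phi>C = DR_to_A12_central[OF \<Phi>] and \<Psi>D = A12_to_DRD[OF \<Psi>]
lemmas \<Phi>_hom = alg_homD(1)[OF \<Phi>D(1)] and \<Psi>_hom = alg_homD(1)[OF \<Psi>D(1)]

lemma \<Psi>_h: "2 * (\<Psi> A12_x * \<Psi> A12_d) = h"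
proof -
  show ?thesis unfolding \<Psi>D(3,4) by (simp only: half_h inverse_cancel_left[OF D.numeral_nz])
qed

text \<open>Used twice: with the localization as \<open>A\<close>, for injectivity of \<Phi>, and
  with \<open>UNIV\<close>, for the extended maps.\<close>

lemma comp_\<Phi>:
  assumes F: "hom_on A F" "\<And>y. F (\<kappa> y) = \<Psi> y" and A: "range \<Phi> \<subseteq> A" "range \<kappa> \<subseteq> A"
  shows "F \<circ> \<Phi> = \<iota>"
proof (rule DR_hom_eqI_central[OF _ DR_alg sk(2)])
  have F1: "F 1 = 1"
    using F(2)[of 1] by (simp add: ring_1_homD(1)[OF hom] ring_1_homD(1)[OF \<Psi>_hom])
  show "alg_hom DR_scal sk (F \<circ> \<Phi>)"
  proof (rule alg_hom_comp[OF \<Phi>D(1) F(1) A(1) F1])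
    show "F (sc c) = sk c" for c using F(2) alg_homD(2)[OF \<Psi>D(1)] by (simp add: sc_def)
  qed
  have "inverse x \<in> A" "x \<in> A" using A \<Phi>D(3) by (auto simp: x_def) (metis rangeI subsetD)
  then have "F (inverse x) = inverse (F x)" using hom_on_inverse[OF F(1)] x_nz F1 by blast
  then show zm: "(F \<circ> \<Phi>) DR_zm = \<iota> DR_zm"
    using z_nz by (simp add: \<Phi>D(3)) (simp add: x_def F(2) \<Psi>D(3) z_def)
  then show "(F \<circ> \<Phi>) DR_zm \<noteq> 0" using z_nz by (simp add: z_def)
  have "2 * (x * d) = \<kappa> (2 * (A12_x * A12_d))" by (simp add: x_def d_def hom_simps[OF hom])
  then show "(F \<circ> \<Phi>) DR_h = \<iota> DR_h"
    using \<Psi>_h by (simp add: \<Phi>D(6) F(2) hom_simps[OF \<Psi>_hom] h_def)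
  have "sc a * \<kappa> A12_nu = \<kappa> (A12_scal a * A12_nu)" "- (sc b * \<kappa> A12_zeta) = \<kappa> (- (A12_scal b * A12_zeta))"
    by (simp_all add: sc_def hom_simps[OF hom])
  then have "F (\<Phi> DR_C1) = (sk a * sk a') * \<iota> DR_C1" "F (\<Phi> DR_C2) = - (sk b * sk b') * \<iota> DR_C2"
    by (simp_all add: \<Phi>C F(2) hom_simps[OF \<Psi>_hom] alg_homD(2)[OF \<Psi>D(1)] \<Psi>D(5,6) mult.assoc)
  moreover have "sk a * sk a' = 1" "- (sk b * sk b') = 1"
    using scaling by (simp_all add: hom_simps[OF sk(2)] flip: ring_1_homD(3)[OF sk(2)])
  ultimately show "(F \<circ> \<Phi>) DR_C1 = \<iota> DR_C1" "(F \<circ> \<Phi>) DR_C2 = \<iota> DR_C2" by simp_all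
qed

lemma comp_\<Psi>:
  assumes F: "hom_on A F" "\<And>y. F (\<iota> y) = \<Phi> y" and A: "range \<Psi> \<subseteq> A" "range \<iota> \<subseteq> A"
  shows "F \<circ> \<Psi> = \<kappa>"
proof (rule A12_hom_eqI[OF _ alg])
  have F1: "F 1 = 1"
    using F(2)[of 1] by (simp add: ring_1_homD(1)[OF DR_hom] ring_1_homD(1)[OF \<Phi>_hom])
  show "alg_hom A12_scal sc (F \<circ> \<Psi>)"
  proof (rule alg_hom_comp[OF \<Psi>D(1) F(1) A(1) F1])
    show "F (sk c) = sc c" for c using F(2) alg_homD(2)[OF \<Phi>D(1)] by (simp add: sk_def)
  qed
  have "inverse z \<in> A" "z \<in> A" using A \<Psi>D(3) by (auto simp: z_def) (metis rangeI subsetD)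
  then have "F (inverse z) = inverse (F z)" using hom_on_inverse[OF F(1)] z_nz F1 by blast
  then show "(F \<circ> \<Psi>) A12_x = \<kappa> A12_x"
    using x_nz by (simp add: \<Psi>D(3)) (simp add: z_def F(2) \<Phi>D(3) x_def)
  have "inverse 2 * z * h = \<iota> (DR_scal (1/2) * DR_zm * DR_h)"
    by (simp only: ring_1_homD(3)[OF DR_hom] alg_homD(2)[OF DR_alg] ring_1_hom_inverse_numeral[OF sk(2)] z_def h_def)
  \<comment> \<open>Here d is recovered as (1/2) x^{-1} (2 x d), because 2 commutes with x.\<close>
  then have "F (\<Psi> A12_d) = inverse 2 * inverse x * (2 * (x * d))"
    by (simp only: \<Psi>D(4) F(2) ring_1_homD(3)[OF \<Phi>_hom] alg_homD(2)[OF \<Phi>D(1)]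
        ring_1_hom_inverse_numeral[OF sc(2)] \<Phi>D(3,6))
  also have "\<dots> = d"
  proof -
    have "2 * (x * d) = x * (2 * d)" using left_commute[of 2 x d] by (simp add: mult_2 mult_2_right)
    then show ?thesis
      by (simp only: mult.assoc inverse_cancel_left[OF x_nz]
          inverse_cancel_left[OF central_scalars_numeral_nonzero[OF sc(1)]])
  qed
  finally show "(F \<circ> \<Psi>) A12_d = \<kappa> A12_d" by (simp add: d_def)
  have "sk a' * \<iota> DR_C1 = \<iota> (DR_scal a' * DR_C1)" "sk b' * \<iota> DR_C2 = \<iota> (DR_scal b' * DR_C2)"
    by (simp_all add: sk_def hom_simps[OF DR_hom])
  then have "F (\<Psi> A12_nu) = (sc a' * sc a) * \<kappa> A12_nu" "F (\<Psi> A12_zeta) = - (sc b' * sc b) * \<kappa> A12_zeta"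
    by (simp_all add: \<Psi>D(5,6) F(2) hom_simps[OF \<Phi>_hom] alg_homD(2)[OF \<Phi>D(1)] \<Phi>C mult.assoc)
  moreover have "sc a' * sc a = 1" "- (sc b' * sc b) = 1"
    using scaling by (simp_all add: hom_simps[OF sc(2)] mult.commute flip: ring_1_homD(3)[OF sc(2)])
  ultimately show "(F \<circ> \<Psi>) A12_nu = \<kappa> A12_nu" "(F \<circ> \<Psi>) A12_zeta = \<kappa> A12_zeta" by simp_all
qed

text \<open>Under \<Psi> the denominators x and 2E + l go to z_-^{-1} and h + l, all nonzero. The
  extension of \<Psi> then composes with \<Phi> to the injection \<iota>.\<close>

lemma inj_\<Phi>: "inj \<Phi>"
proof -
  have "\<Psi> s \<noteq> 0" if "s \<in> A12_denoms" for s
  proof (rule mult_closure_nonzero[OF \<Psi>_hom _ that[unfolded denoms]])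
    fix g assume "g \<in> {A12_x} \<union> range hl"
    then show "\<Psi> g \<noteq> 0"
    proof (cases rule: generator_cases)
      case 1
      then show ?thesis using \<Psi>D(3) z_nz by simp
    next
      case (2 l)
      have "\<Psi> (hl l) = h + of_int l"
        by (simp add: hl_def hom_simps[OF \<Psi>_hom] alg_homD(2)[OF \<Psi>D(1)] ring_1_hom_of_int[OF sk(2)] \<Psi>_h)
      then show ?thesis using D.h_nz 2 by simp
    qed
  qed
  then obtain F where F: "hom_on (localization \<kappa> A12_denoms) F" "\<And>y. F (\<kappa> y) = \<Psi> y"
    using frac.extension_to_localization[OF \<Psi>_hom] by blast
  have "F \<circ> \<Phi> = \<iota>"
    by (rule comp_\<Phi>[OF F \<Phi>D(2)]) (use frac.image_in_localization in auto)
  then show ?thesis using DR_inj by (metis inj_on_imageI2)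
qed

lemma inj_\<Psi>: "inj \<Psi>"
proof -
  have "\<Phi> s \<noteq> 0" if "s \<in> DR_denoms" for s
    by (rule mult_closure_nonzero[OF \<Phi>_hom _ that[unfolded DR_denoms_def]]) (use \<Phi>D(3) x_nz in auto)
  then obtain F where F: "hom_on (localization \<iota> DR_denoms) F" "\<And>y. F (\<iota> y) = \<Phi> y"
    using dr_frac.extension_to_localization[OF \<Phi>_hom] by blast
  have "F \<circ> \<Psi> = \<kappa>"
    by (rule comp_\<Psi>[OF F \<Psi>D(2)]) (use dr_frac.image_in_localization in auto)
  then show ?thesis using inj by (metis inj_on_imageI2)
qed

theorem inverse_on_fracs: "inverse_on_fracs \<iota> \<kappa> \<Phi> \<Psi>"
proof -
  \<comment> \<open>Compatibility with scalars is automatic, since they come from the algebra on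
    which the extension is prescribed.\<close>
  have ext_iff: "extends_to_frac (\<iota> \<circ> DR_scal) (\<kappa> \<circ> A12_scal) \<iota> \<Phi> F \<longleftrightarrow> ring_1_hom F \<and> F \<circ> \<iota> = \<Phi>"
    "extends_to_frac (\<kappa> \<circ> A12_scal) (\<iota> \<circ> DR_scal) \<kappa> \<Psi> G \<longleftrightarrow> ring_1_hom G \<and> G \<circ> \<kappa> = \<Psi>" for F G
    using alg_homD(2)[OF \<Phi>D(1)] alg_homD(2)[OF \<Psi>D(1)]
    by (auto simp: extends_to_frac_def alg_hom_def fun_eq_iff sc_def sk_def)
  have F_ex: "\<exists>!F. ring_1_hom F \<and> F \<circ> \<iota> = \<Phi>"
    by (rule extension_to_fractions[OF \<iota> \<Phi>_hom inj_\<Phi>]) blast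
  have G_ex: "\<exists>!G. ring_1_hom G \<and> G \<circ> \<kappa> = \<Psi>"
    by (rule extension_to_fractions[OF \<kappa> \<Psi>_hom inj_\<Psi>]) blast
  have "G \<circ> F = id \<and> F \<circ> G = id"
    if F: "ring_1_hom F" "F \<circ> \<iota> = \<Phi>" and G: "ring_1_hom G" "G \<circ> \<kappa> = \<Psi>" for F G
  proof
    \<comment> \<open>Uniqueness of extensions, applied to the embedding itself: a homomorphism that
      fixes the algebra is the identity on its fractions.\<close>
    have id_unique: "F' = id" if "skew_field_of_fractions j" "ring_1_hom F'" "F' \<circ> j = j"
      for j :: "'r::{ring,monoid_mult} \<Rightarrow> 'q::division_ring" and F'
    proof -
      have "ring_1_hom (id :: 'q \<Rightarrow> 'q)" by (simp add: ring_1_hom_def)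
      then show ?thesis
        using extension_to_fractions[OF that(1) skew_field_of_fractionsD[OF that(1)]] that(2,3)
        by (metis id_comp)
    qed
    have "hom_on UNIV G" "hom_on UNIV F" using F G by (simp_all add: hom_on_def ring_1_hom_def)
    moreover have "G (\<kappa> y) = \<Psi> y" "F (\<iota> q) = \<Phi> q" for y q using F(2) G(2) by (auto simp: fun_eq_iff)
    ultimately have "G \<circ> \<Phi> = \<iota>" "F \<circ> \<Psi> = \<kappa>"
      using comp_\<Phi>[of UNIV G] comp_\<Psi>[of UNIV F] by simp_all
    then have c: "G \<circ> F \<circ> \<iota> = \<iota>" "F \<circ> G \<circ> \<kappa> = \<kappa>" using F(2) G(2) by (simp_all add: comp_assoc)
    show "G \<circ> F = id" by (rule id_unique[OF \<iota> ring_1_hom_comp[OF F(1) G(1)] c(1)])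
    show "F \<circ> G = id" by (rule id_unique[OF \<kappa> ring_1_hom_comp[OF G(1) F(1)] c(2)])
  qed
  then show ?thesis
    unfolding inverse_on_fracs_def ext_iff using F_ex G_ex by (metis o_bij)
qed

end

theorem mainTheorem2:
  fixes \<iota> :: "DR \<Rightarrow> 'k::division_ring" and \<kappa> :: "A12 \<Rightarrow> 'l::division_ring"
  assumes "skew_field_of_fractions \<iota>" and "skew_field_of_fractions \<kappa>"
  shows
    "right_ore_set A12_denoms \<and> right_ore_set DR_denoms \<and>
     (\<exists>!\<Phi>. DR_to_A12 \<kappa> (\<kappa> A12_nu) (\<kappa> A12_zeta) \<Phi>) \<and>
     (\<exists>!\<Psi>. A12_to_DR \<iota> (2 * \<iota> DR_C1) (\<iota> DR_C2) \<Psi>) \<and>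
     (\<exists>!\<Psi>. A12_to_DR \<iota> (\<iota> DR_C1) (- \<iota> DR_C2) \<Psi>) \<and>
     (\<exists>!\<Phi>. DR_to_A12 \<kappa> (\<kappa> A12_nu / 2) (- \<kappa> A12_zeta) \<Phi>) \<and>
     (\<forall>\<Phi> \<Psi>. DR_to_A12 \<kappa> (\<kappa> A12_nu) (\<kappa> A12_zeta) \<Phi> \<and> A12_to_DR \<iota> (\<iota> DR_C1) (- \<iota> DR_C2) \<Psi> \<longrightarrow>
        inverse_on_fracs \<iota> \<kappa> \<Phi> \<Psi>) \<and>
     (\<forall>\<Phi> \<Psi>. DR_to_A12 \<kappa> (\<kappa> A12_nu / 2) (- \<kappa> A12_zeta) \<Phi> \<and> A12_to_DR \<iota> (2 * \<iota> DR_C1) (\<iota> DR_C2) \<Psi> \<longrightarrow>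
        inverse_on_fracs \<iota> \<kappa> \<Phi> \<Psi>)"
proof -
  interpret DR_A12_fractions \<kappa> \<iota> by unfold_locales (rule assms)+
  have sc_eqs: "sc 1 * q = q" "sc (-1) * q = - q" "sc (1/2) * q = q / 2" for q
  proof -
    show "sc 1 * q = q" "sc (-1) * q = - q" by (simp_all add: hom_simps[OF sc(2)])
    have "sc (1/2) * q = q * sc (1/2)" using sc(1) by (simp add: central_scalars_def)
    moreover have "sc (1/2) = inverse 2" by (rule ring_1_hom_inverse_numeral[OF sc(2)])
    ultimately show "sc (1/2) * q = q / 2" by (simp only: divide_inverse)
  qed
  have sk_eqs: "sk 1 * q = q" "sk (-1) * q = - q" "sk 2 * q = 2 * q" for q
    by (simp_all add: hom_simps[OF sk(2)])
  have inv: "inverse_on_fracs \<iota> \<kappa> \<Phi> \<Psi>"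
    if "DR_to_A12 \<kappa> (sc a * \<kappa> A12_nu) (sc b * \<kappa> A12_zeta) \<Phi>"
      "A12_to_DR \<iota> (sk a' * \<iota> DR_C1) (sk b' * \<iota> DR_C2) \<Psi>" "a * a' = 1" "b * b' = -1"
    for a b a' b' \<Phi> \<Psi>
    by (rule mutually_inverse.inverse_on_fracs) (unfold_locales, (rule that)+)
  \<comment> \<open>The variables of \<open>inv\<close> occur in the order a, b, \<Phi>, a', b',
    \<Psi>, hence the placeholder in third position.\<close>
  show ?thesis
    using ore_set DR_ore_set DR_to_A12_unique[of 1 1] DR_to_A12_unique[of "1/2" "-1"]
      A12_to_DR_unique[of 2 1] A12_to_DR_unique[of 1 "-1"]
      inv[of 1 1 _ 1 "-1"] inv[of "1/2" "-1" _ 2 1]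
    unfolding sc_eqs sk_eqs by simp
qed

end
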